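(* There exists an absolute constant $\varkappa>0$ such that for every real number $\alpha$ and every real $X\geqslant 2$, $$ S=\sum_{n\leqslant X}\varepsilon(n)\Lambda(n)e^{2\pi i\alpha n}=O\!\left(X^{1-\varkappa}\right), $$ where the implied constant in $O$ is absolute (independent of $\alpha$ and $X$).
   Context: For a nonnegative integer $n=e_0+e_12+\dots+e_k2^k$ with $e_j\in\{0,1\}$ (its binary expansion), $\varepsilon(n)=1$ if the number of ones among the binary digits $e_j$ is even, and $\varepsilon(n)=-1$ otherwise; i.e. $\varepsilon(n)=(-1)^{e_0+\dots+e_k}$. $\Lambda$ denotes the von Mangoldt function. *)

theory Defs
  imports Complex_Main "HOL-Number_Theory.Prime_Powers"
begin

lemma finite_binary_ones: "finite {j. bit (n :: nat) j}"
proof (rule finite_subset)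
  show "{j. bit n j} \<subseteq> {..<n}"
  proof
    fix j assume "j \<in> {j. bit n j}"
    then have "2 ^ j \<le> n"
      by (metis bit_nat_def div_less even_zero linorder_not_less mem_Collect_eq)
    then show "j \<in> {..<n}"
      using less_le_trans[OF less_exp] by blast
  qed
qed simp

definition thue_morse :: "nat \<Rightarrow> int" where
  "thue_morse n = (if even (card {j. bit n j}) then 1 else - 1)"

end

theory Submission
  imports Defs "HOL-Analysis.Analysis" "HOL-Real_Asymp.Real_Asymp"
    "HOL-Computational_Algebra.Squarefree"
begin

text \<open>
  Vaughan's identity splits the sum into linear and bilinear sums with cut-off a small power of
  the length. The linear sums run over multiples of a modulus; detecting these by additive
  characters reduces them to the uniform bound for Thue--Morse polynomials, whose absolute values
  are products of the factors \<open>2 \<bar>sin (\<pi> 2\<^sup>j x)\<bar>\<close>, two consecutive ones being at most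
  \<open>4 \<cdot> 4 / 5\<close>.

  For a bilinear sum over \<open>m \<sim> 2\<^sup>i\<close> and \<open>n \<sim> 2\<^sup>j\<close> with \<open>i \<le> j\<close>, the argument is that of
  Mauduit and Rivat. The Cauchy--Schwarz and van der Corput inequalities lead to the correlations
  of \<open>\<epsilon>(m (n + r)) \<epsilon>(m n)\<close> with small \<open>r\<close>; here only the lowest \<open>i + 2t\<close> digits matter, up to few
  exceptional carries. Expanding the periodic truncations into Fourier series, the sum over \<open>m\<close> becomes
  geometric, \<open>n\<close> equidistributes its frequency, and the saving comes from the fact that the
  \<open>L\<^sup>1\<close> norm of the Fourier transform grows more slowly than the square root of the modulus: two
  digits contribute a factor at most \<open>\<surd>(2 + \<surd>2) < 37 / 20 < 2\<close>. The twist \<open>\<alpha>\<close> only shifts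
  frequencies, so it is harmless.
\<close>

text \<open>The obstacle is quantitative. Opening both sign factors of a correlation squares the
  first moment of the Fourier coefficients, so a first moment of exact square-root size returns only
  the trivial bound. A single digit gives no better, because |sin| + |cos| can reach sqrt 2; the
  estimates with a saving therefore take two digits at a time, and any constant below 2 for the pair
  suffices. Frequency pairs whose difference is divisible by a high power of two profit little from
  the first moment; there the decay of the individual coefficients takes over. In Vaughan's identity
  only the von Mangoldt factor is truncated. The convolution of 1 with its upper part lies between 0
  and the logarithm, so the bilinear coefficients are bounded and no divisor moments occur. The
  exponent comes from a chain of choices for length about \<open>4 ^ K\<close>: cut-off
  \<open>2 ^ u\<close> with \<open>u\<close> near \<open>K / 30\<close>, shifts below
  \<open>2 ^ t\<close> with \<open>t\<close> near \<open>u / 300\<close>, a square root from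
  Cauchy--Schwarz, and half of the result given up for powers of the logarithm.\<close>

abbreviation (input) tm :: "nat \<Rightarrow> complex" where
  "tm n \<equiv> of_int (thue_morse n)"

definition ee :: "real \<Rightarrow> complex" where
  "ee x = cis (2 * pi * x)"

section \<open>Digit recursions for the signs, and additive characters\<close>

lemma abs_thue_morse [simp]: "\<bar>real_of_int (thue_morse n)\<bar> = 1"
  by (simp add: thue_morse_def)

lemma thue_morse_0 [simp]: "thue_morse 0 = 1"
  by (simp add: thue_morse_def)

lemma thue_morse_double [simp]: "thue_morse (2 * n) = thue_morse n"
proof -
  have "{j. bit (2 * n) j} = Suc ` {j. bit n j}"
  proof (intro set_eqI iffI)
    fix j assume "j \<in> {j. bit (2 * n) j}"
    then show "j \<in> Suc ` {j. bit n j}"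
      by (cases j) (auto simp: bit_0 bit_Suc)
  qed (auto simp: bit_Suc)
  then show ?thesis
    by (simp add: thue_morse_def card_image)
qed

lemma thue_morse_Suc_double [simp]: "thue_morse (Suc (2 * n)) = - thue_morse n"
proof -
  have "{j. bit (Suc (2 * n)) j} = insert 0 (Suc ` {j. bit n j})"
  proof (intro set_eqI iffI)
    fix j assume "j \<in> {j. bit (Suc (2 * n)) j}"
    then show "j \<in> insert 0 (Suc ` {j. bit n j})"
      by (cases j) (auto simp: bit_0 bit_Suc)
  qed (auto simp: bit_Suc bit_0)
  then show ?thesis
    by (simp add: thue_morse_def card_image finite_binary_ones)
qed

text \<open>The digits of \<open>z\<close> and of \<open>u\<close> occupy disjoint positions, so the
  parities of their digit counts add.\<close>

lemma thue_morse_split: "u < 2 ^ k \<Longrightarrow> thue_morse (2 ^ k * z + u) = thue_morse z * thue_morse u"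
proof (induction k arbitrary: u)
  case (Suc k)
  define v where "v = u div 2"
  have v: "v < 2 ^ k"
    using Suc.prems by (auto simp: v_def)
  show ?case
  proof (cases "even u")
    case True
    then have u: "u = 2 * v" by (simp add: v_def)
    have "2 ^ Suc k * z + u = 2 * (2 ^ k * z + v)" by (simp add: u)
    then have "thue_morse (2 ^ Suc k * z + u) = thue_morse (2 ^ k * z + v)" by (simp only: thue_morse_double)
    then show ?thesis using Suc.IH[OF v] u by simp
  next
    case False
    then have u: "u = Suc (2 * v)" by (simp add: v_def)
    have "2 ^ Suc k * z + u = Suc (2 * (2 ^ k * z + v))" by (simp add: u)
    then have "thue_morse (2 ^ Suc k * z + u) = - thue_morse (2 ^ k * z + v)" by (simp only: thue_morse_Suc_double)
    then show ?thesis using Suc.IH[OF v] u by simp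
  qed
qed simp

lemma norm_ee [simp]: "norm (ee x) = 1"
  by (simp add: ee_def)

lemma ee_0 [simp]: "ee 0 = 1"
  by (simp add: ee_def)

lemma ee_add: "ee (x + y) = ee x * ee y"
  by (simp add: ee_def cis_mult distrib_left)

lemma ee_minus: "ee (- x) = cnj (ee x)"
  by (simp add: ee_def cis_cnj)

lemma ee_int [simp]: "ee (of_int n) = 1"
  by (metis cis_multiple_2pi ee_def Ints_of_int mult.commute)

lemma ee_power: "ee x ^ n = ee (of_nat n * x)"
  by (simp only: ee_def Complex.DeMoivre mult_ac)

lemma norm_1_minus_ee: "norm (1 - ee x) = 2 * \<bar>sin (pi * x)\<bar>"
  using dist_exp_i_1[of "2 * pi * x"] by (simp add: ee_def cis_conv_exp norm_minus_commute)

lemma ee_eq_1_iff: "ee x = 1 \<longleftrightarrow> sin (pi * x) = 0"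
  using norm_1_minus_ee[of x] by (metis abs_eq_0 eq_iff_diff_eq_0 mult_eq_0_iff norm_eq_zero zero_neq_numeral)

subsection \<open>Thue--Morse polynomials\<close>

text \<open>Up to the factor \<open>2 ^ k\<close> this is the modulus of the Thue--Morse polynomial
  of length \<open>2 ^ k\<close>. The normalisation makes 1 the trivial bound and makes the Fourier
  coefficients below have exactly these moduli.\<close>

primrec sin_prod :: "nat \<Rightarrow> real \<Rightarrow> real" where
  "sin_prod 0 x = 1"
| "sin_prod (Suc k) x = \<bar>sin (pi * x)\<bar> * sin_prod k (2 * x)"

lemma sin_prod_nonneg [simp]: "0 \<le> sin_prod k x"
  by (induction k arbitrary: x) auto

lemma abs_sin_pi_add_int: "\<bar>sin (pi * (x + of_int n))\<bar> = \<bar>sin (pi * x)\<bar>"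
proof -
  have "\<bar>cos (pi * of_int n)\<bar> = 1"
    by (metis cos_npi_int abs_1 abs_minus_cancel)
  moreover have "sin (pi * of_int n) = 0" by simp
  ultimately show ?thesis
    by (simp add: distrib_left sin_add abs_mult)
qed

lemma sin_prod_add_int: "sin_prod k (x + of_int n) = sin_prod k x"
proof (induction k arbitrary: x n)
  case (Suc k)
  have "2 * (x + of_int n) = 2 * x + of_int (2 * n)" by simp
  then have "sin_prod k (2 * (x + of_int n)) = sin_prod k (2 * x)" by (metis Suc.IH)
  then show ?case by (simp only: sin_prod.simps abs_sin_pi_add_int)
qed simp

lemma sin_prod_add_nat: "sin_prod k (x + of_nat n) = sin_prod k x"
  by (metis of_int_of_nat_eq sin_prod_add_int)

lemma sin_prod_add: "sin_prod (a + b) x = sin_prod a x * sin_prod b (2 ^ a * x)"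
  by (induction a arbitrary: x) (simp_all add: mult_ac)

lemma sum_split_even_odd: "(\<Sum>v<2 * n. f v) = (\<Sum>v<n. f (2 * v) + f (Suc (2 * v)))"
  for f :: "nat \<Rightarrow> 'a :: comm_monoid_add"
  by (induction n) (simp_all add: add_ac)

text \<open>The terms at \<open>2 * v\<close> and \<open>2 * v + 1\<close> have opposite signs and
  consecutive phases, so \<open>1 - ee \<theta>\<close> factors out and the frequency doubles. Any
  even length is allowed, which the incomplete sums need.\<close>

lemma tm_sum_double:
  "(\<Sum>x<2 * Y. tm x * ee (of_nat x * \<theta>)) = (1 - ee \<theta>) * (\<Sum>x<Y. tm x * ee (of_nat x * (2 * \<theta>)))"
proof -
  have *: "tm (2 * v) * ee (of_nat (2 * v) * \<theta>) + tm (Suc (2 * v)) * ee (of_nat (Suc (2 * v)) * \<theta>)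
      = (1 - ee \<theta>) * (tm v * ee (of_nat v * (2 * \<theta>)))" for v
  proof -
    have "of_nat (Suc (2 * v)) * \<theta> = of_nat v * (2 * \<theta>) + \<theta>"
      by (simp add: algebra_simps)
    then have 1: "ee (of_nat (Suc (2 * v)) * \<theta>) = ee (of_nat v * (2 * \<theta>)) * ee \<theta>"
      by (simp only: ee_add)
    have 2: "of_nat (2 * v) * \<theta> = of_nat v * (2 * \<theta>)" by simp
    show ?thesis
      unfolding 1 2 thue_morse_double thue_morse_Suc_double of_int_minus by (rule complex_eqI) (simp_all add: algebra_simps)
  qed
  show ?thesis
    by (simp only: sum_split_even_odd * sum_distrib_left)
qed

lemma norm_tm_poly:
  "norm (\<Sum>v<2 ^ k. tm v * ee (of_nat v * x)) = 2 ^ k * sin_prod k x"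
proof (induction k arbitrary: x)
  case (Suc k)
  show ?case
    by (simp only: power_Suc tm_sum_double norm_mult norm_1_minus_ee Suc.IH sin_prod.simps) simp
qed simp

lemma sin_mult_sin_double_le: "\<bar>sin x * sin (2 * x)\<bar> \<le> (4::real) / 5"
proof -
  define y where "y = (sin x)\<^sup>2"
  have y: "0 \<le> y" "y \<le> 1" by (auto simp: y_def abs_square_le_1)
  have "(sin x * sin (2 * x))\<^sup>2 = 4 * y\<^sup>2 * (cos x)\<^sup>2"
    by (simp add: y_def sin_double power2_eq_square)
  also have "\<dots> = 4 * y\<^sup>2 * (1 - y)"
    by (simp add: y_def cos_squared_eq)
  \<comment> \<open>The cubic has its maximum 16/27 on the unit interval at
    \<open>y = 2 / 3\<close>; this form displays the double root there. The rational 4/5 is slightly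
    above \<open>sqrt (16 / 27)\<close>.\<close>
  also have "\<dots> = 16 / 27 - 4 * (y - 2 / 3)\<^sup>2 * (y + 1 / 3)"
    by (simp add: field_simps power2_eq_square)
  also have "\<dots> \<le> 16 / 27 - 0"
    using y by (intro diff_left_mono mult_nonneg_nonneg) auto
  also have "\<dots> \<le> (4 / 5)\<^sup>2" by (simp add: power2_eq_square)
  finally show ?thesis
    by (simp add: abs_le_square_iff[symmetric] abs_le_square_iff)
qed

lemma sin_prod_Suc_Suc: "sin_prod (Suc (Suc k)) x = \<bar>sin (pi * x) * sin (2 * (pi * x))\<bar> * sin_prod k (4 * x)"
  by (simp add: abs_mult mult_ac)

text \<open>Each pair of factors contributes 16/25 to the square; the prefactor 5/4 pays for the
  unpaired factor when \<open>k\<close> is odd.\<close>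

lemma sin_prod_sq_le: "(sin_prod k x)\<^sup>2 \<le> 5 / 4 * (4 / 5) ^ k"
proof (induction k arbitrary: x rule: induct_nat_012)
  case (ge2 n)
  have "(sin_prod (Suc (Suc n)) x)\<^sup>2 = \<bar>sin (pi * x) * sin (2 * (pi * x))\<bar>\<^sup>2 * (sin_prod n (4 * x))\<^sup>2"
    by (simp only: sin_prod_Suc_Suc power_mult_distrib)
  also have "\<dots> \<le> (4 / 5)\<^sup>2 * (5 / 4 * (4 / 5) ^ n)"
    by (intro mult_mono ge2(1) power_mono sin_mult_sin_double_le) auto
  finally show ?case by (simp add: power2_eq_square)
qed (auto simp: abs_square_le_1)

section \<open>Second and first moments of the sine products over dyadic grids\<close>

lemma sum_lessThan_add:
  "(\<Sum>i<m + n. f i) = (\<Sum>i<m. f i) + (\<Sum>i<n. f (m + i))"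
  for f :: "nat \<Rightarrow> 'a :: comm_monoid_add"
  by (induction n) (simp_all add: add_ac)

lemma sum_lessThan_double:
  "(\<Sum>i<2 * n. f i) = (\<Sum>i<n. f i + f (n + i))"
  for f :: "nat \<Rightarrow> 'a :: comm_monoid_add"
  by (simp add: mult_2 sum_lessThan_add sum.distrib)

lemma sin_shift_half: "\<bar>sin (pi * (y + 1 / 2))\<bar> = \<bar>cos (pi * y)\<bar>"
  by (simp add: distrib_left sin_add)

text \<open>Parseval, on an arbitrary translate of the grid. The indices \<open>b\<close> and
  \<open>2 ^ k + b\<close> give points half a unit apart, where the later factors agree and the
  squares of the first ones add up to 1.\<close>

lemma sin_prod_sum_sq: "(\<Sum>b<2 ^ k. (sin_prod k ((of_nat b + t) / 2 ^ k))\<^sup>2) = 1"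
proof (induction k)
  case (Suc k)
  have *: "(sin_prod (Suc k) ((of_nat b + t) / 2 ^ Suc k))\<^sup>2 + (sin_prod (Suc k) ((of_nat (2 ^ k + b) + t) / 2 ^ Suc k))\<^sup>2
     = (sin_prod k ((of_nat b + t) / 2 ^ k))\<^sup>2" for b
  proof -
    define y where "y = (of_nat b + t) / 2 ^ Suc k"
    have y2: "2 * y = (of_nat b + t) / 2 ^ k" by (simp add: y_def divide_simps)
    have s: "(of_nat (2 ^ k + b) + t) / 2 ^ Suc k = y + 1 / 2"
      by (simp add: y_def field_simps)
    have "sin_prod k (2 * (y + 1 / 2)) = sin_prod k (2 * y)"
      using sin_prod_add_nat[of k "2 * y" 1] by (simp add: algebra_simps)
    then have "(sin_prod (Suc k) y)\<^sup>2 + (sin_prod (Suc k) (y + 1 / 2))\<^sup>2 = ((sin (pi * y))\<^sup>2 + (cos (pi * y))\<^sup>2) * (sin_prod k (2 * y))\<^sup>2"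
      by (simp add: sin_shift_half power_mult_distrib distrib_right del: sin_cos_squared_add)
    then show ?thesis unfolding s y_def[symmetric] y2[symmetric] by simp
  qed
  show ?case
    by (simp only: power_Suc sum_lessThan_double)
       (simp only: *[unfolded power_Suc] Suc.IH)
qed simp

text \<open>Two arguments \<open>pi / 2\<close> apart contribute \<open>s * sqrt (1 + s)\<close>,
  and moving by \<open>pi / 4\<close> exchanges \<open>s\<close> with \<open>c\<close>. As the
  squares of \<open>s\<close> and \<open>c\<close> sum to 1, Cauchy--Schwarz bounds the square of
  the total by \<open>2 + s + c\<close>.\<close>

lemma four_shift_bound:
  fixes a :: real
  defines "g \<equiv> \<lambda>x. \<bar>sin x * sin (2 * x)\<bar>"
  shows "g a + g (a + pi / 4) + g (a + pi / 2) + g (a + 3 * pi / 4) \<le> 37 / 20"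
proof -
  define s c where "s = \<bar>sin (2 * a)\<bar>" and "c = \<bar>cos (2 * a)\<bar>"
  have sc: "s\<^sup>2 + c\<^sup>2 = 1" "s \<ge> 0" "c \<ge> 0" by (auto simp: s_def c_def)
  have sq: "\<bar>sin x\<bar> + \<bar>cos x\<bar> = sqrt (1 + \<bar>sin (2 * x)\<bar>)" for x :: real
  proof (rule sym, rule real_sqrt_unique)
    show "(\<bar>sin x\<bar> + \<bar>cos x\<bar>)\<^sup>2 = 1 + \<bar>sin (2 * x)\<bar>"
      by (simp add: power2_sum sin_double abs_mult)
  qed simp
  have pair: "g x + g (x + pi / 2) = \<bar>sin (2 * x)\<bar> * sqrt (1 + \<bar>sin (2 * x)\<bar>)" for x
  proof -
    have "sin (x + pi / 2) = cos x" by (simp add: sin_add)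
    moreover have "\<bar>sin (2 * (x + pi / 2))\<bar> = \<bar>sin (2 * x)\<bar>" by (simp add: distrib_left)
    ultimately show ?thesis
      by (simp add: g_def abs_mult flip: sq) (simp add: algebra_simps)
  qed
  have e1: "g a + g (a + pi / 2) = s * sqrt (1 + s)" using pair[of a] by (simp add: s_def)
  have "\<bar>sin (2 * (a + pi / 4))\<bar> = c"
    by (simp add: c_def distrib_left sin_add)
  then have e2: "g (a + pi / 4) + g (a + 3 * pi / 4) = c * sqrt (1 + c)"
    using pair[of "a + pi / 4"] by (simp add: add.assoc)
  have cs: "(s * u + c * v)\<^sup>2 \<le> (s\<^sup>2 + c\<^sup>2) * (u\<^sup>2 + v\<^sup>2)" for u v :: real
  proof -
    have "(s\<^sup>2 + c\<^sup>2) * (u\<^sup>2 + v\<^sup>2) - (s * u + c * v)\<^sup>2 = (s * v - c * u)\<^sup>2"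
      by (simp add: power2_eq_square algebra_simps)
    then show ?thesis by (metis diff_ge_0_iff_ge zero_le_power2)
  qed
  have "(s + c)\<^sup>2 \<le> 2"
    using sc(1) sum_squares_bound[of s c] by (simp add: power2_sum)
  \<comment> \<open>569/400 is the square of 37/20 minus 2, a rational just above
    \<open>sqrt 2\<close>.\<close>
  also have "\<dots> \<le> (569 / 400)\<^sup>2" by (simp add: power2_eq_square)
  finally have "s + c \<le> 569 / 400" by (rule power2_le_imp_le) simp
  then have "(s * sqrt (1 + s) + c * sqrt (1 + c))\<^sup>2 \<le> (37 / 20)\<^sup>2"
    using cs[of "sqrt (1 + s)" "sqrt (1 + c)"] sc by (simp add: power2_eq_square)
  then have "s * sqrt (1 + s) + c * sqrt (1 + c) \<le> 37 / 20"
    by (rule power2_le_imp_le) simp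
  then show ?thesis using e1 e2 by linarith
qed

lemma sum_lessThan_four:
  "(\<Sum>i<4 * n. f i) = (\<Sum>i<n. f i + f (n + i) + f (2 * n + i) + f (3 * n + i))"
  for f :: "nat \<Rightarrow> 'a :: comm_monoid_add"
proof -
  have "4 * n = n + (n + (n + n))" by simp
  then show ?thesis
    by (simp only: sum_lessThan_add) (simp add: sum.distrib add_ac numeral_3_eq_3 mult_2)
qed

text \<open>The indices \<open>b + j * 2 ^ k\<close> with \<open>j < 4\<close> give the points
  \<open>y + j / 4\<close>. Multiplication by 4 identifies these modulo 1, so the last
  \<open>k\<close> factors are common and \<open>four_shift_bound\<close> sums the first
  two.\<close>

lemma sin_prod_sum_Suc_Suc_le:
  assumes "\<And>t. (\<Sum>b<2 ^ k. sin_prod k ((of_nat b + t) / 2 ^ k)) \<le> B"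
  shows "(\<Sum>b<2 ^ Suc (Suc k). sin_prod (Suc (Suc k)) ((of_nat b + t) / 2 ^ Suc (Suc k))) \<le> 37 / 20 * B"
proof -
  let ?f = "\<lambda>b. sin_prod (Suc (Suc k)) ((of_nat b + t) / 2 ^ Suc (Suc k))"
  have *: "?f b + ?f (2 ^ k + b) + ?f (2 * 2 ^ k + b) + ?f (3 * 2 ^ k + b)
     \<le> 37 / 20 * sin_prod k ((of_nat b + t) / 2 ^ k)" for b
  proof -
    define y where "y = (of_nat b + t) / 2 ^ Suc (Suc k)"
    have y4: "4 * y = (of_nat b + t) / 2 ^ k" by (simp add: y_def divide_simps)
    have s: "(of_nat (j * 2 ^ k + b) + t) / 2 ^ Suc (Suc k) = y + of_nat j / 4" for j
      by (simp add: y_def field_simps)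
    have r: "sin_prod k (4 * (y + of_nat j / 4)) = sin_prod k (4 * y)" for j
      using sin_prod_add_nat[of k "4 * y" j] by (simp add: algebra_simps)
    have g: "?f (j * 2 ^ k + b) = \<bar>sin (pi * y + j * pi / 4) * sin (2 * (pi * y + j * pi / 4))\<bar> * sin_prod k (4 * y)" for j
      unfolding s sin_prod_Suc_Suc r by (simp add: distrib_left mult_ac)
    have "?f (0 * 2 ^ k + b) + ?f (1 * 2 ^ k + b) + ?f (2 * 2 ^ k + b) + ?f (3 * 2 ^ k + b)
      \<le> 37 / 20 * sin_prod k (4 * y)"
      unfolding g distrib_right[symmetric]
      using four_shift_bound[of "pi * y"] by (intro mult_right_mono) auto
    then show ?thesis by (simp add: y4)
  qed
  have "2 ^ Suc (Suc k) = (4::nat) * 2 ^ k" by simp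
  then have "(\<Sum>b<2 ^ Suc (Suc k). ?f b)
     = (\<Sum>b<2^k. ?f b + ?f (2 ^ k + b) + ?f (2 * 2 ^ k + b) + ?f (3 * 2 ^ k + b))"
    by (simp only: sum_lessThan_four)
  also have "\<dots> \<le> (\<Sum>b<2^k. 37 / 20 * sin_prod k ((of_nat b + t) / 2 ^ k))"
    by (intro sum_mono *)
  also have "\<dots> \<le> 37 / 20 * B"
    unfolding sum_distrib_left[symmetric] by (intro mult_left_mono assms) simp
  finally show ?thesis .
qed

text \<open>Uniformity in \<open>t\<close> matters: frequencies restricted to a residue class form a
  translate of a coarser grid. The factor 2 under the root covers the start at \<open>k = 1\<close>,
  where only \<open>sqrt 2\<close> is available.\<close>

lemma sin_prod_sum_le: "(\<Sum>b<2 ^ k. sin_prod k ((of_nat b + t) / 2 ^ k)) \<le> sqrt (2 * (37 / 20) ^ k)"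
proof (induction k arbitrary: t rule: induct_nat_012)
  case 1
  have "\<bar>sin x\<bar> + \<bar>cos x\<bar> \<le> sqrt 2" for x :: real
  proof (rule real_le_rsqrt)
    show "(\<bar>sin x\<bar> + \<bar>cos x\<bar>)\<^sup>2 \<le> 2"
      using sum_squares_bound[of "\<bar>sin x\<bar>" "\<bar>cos x\<bar>"] by (simp add: power2_sum)
  qed
  then have "\<bar>sin (pi * (t / 2))\<bar> + \<bar>sin (pi * (t / 2 + 1 / 2))\<bar> \<le> sqrt 2"
    by (simp only: sin_shift_half)
  also have "sqrt 2 \<le> sqrt (2 * (37 / 20))" by (rule real_sqrt_le_mono) simp
  finally show ?case by (simp add: numeral_2_eq_2 add_divide_distrib add_ac)
next
  case (ge2 n)
  have "37 / 20 * sqrt (2 * (37 / 20) ^ n) = sqrt ((37/20)\<^sup>2 * (2 * (37 / 20) ^ n))"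
    by (simp only: real_sqrt_mult real_sqrt_abs)
  also have "(37/20)\<^sup>2 * (2 * (37 / 20) ^ n) = (2::real) * (37 / 20) ^ Suc (Suc n)"
    by (simp add: power2_eq_square)
  finally show ?case using sin_prod_sum_Suc_Suc_le[OF ge2(1)] by simp
qed simp

text \<open>Induction on base-4 digits: two binary digits cost 4 * 4/5 = 16/5, rounded up to 7/2.
  Subtracting 8 absorbs the at most three leftover terms at each level and makes the claim hold for
  the empty sum at \<open>K = 0\<close>.\<close>

lemma norm_tm_sum_le:
  "Y < 4 ^ K \<Longrightarrow> norm (\<Sum>x<Y. tm x * ee (of_nat x * \<theta>)) \<le> 8 * (7 / 2) ^ K - 8"
proof (induction K arbitrary: Y \<theta>)
  case (Suc K)
  define Z where "Z = Y div 4"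
  define W where "W = Y - 4 * Z"
  have Z: "Z < 4 ^ K" using Suc.prems by (simp add: Z_def less_mult_imp_div_less)
  have W: "Y = 2 * (2 * Z) + W" "W \<le> 3"
    by (auto simp: W_def Z_def)
  let ?G = "\<lambda>Y \<theta>. \<Sum>x<Y. tm x * ee (of_nat x * \<theta>)"
  have "norm (?G (2 * (2 * Z)) \<theta>) = norm (1 - ee \<theta>) * norm (1 - ee (2 * \<theta>)) * norm (?G Z (2 * (2 * \<theta>)))"
    by (simp only: tm_sum_double norm_mult mult.assoc)
  also have "\<dots> = 4 * \<bar>sin (pi * \<theta>) * sin (2 * (pi * \<theta>))\<bar> * norm (?G Z (2 * (2 * \<theta>)))"
    by (simp add: norm_1_minus_ee abs_mult mult_ac)
  also have "\<dots> \<le> (4 * (4 / 5)) * (8 * (7 / 2) ^ K - 8)"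
    by (intro mult_mono sin_mult_sin_double_le mult_left_mono Suc.IH Z) auto
  finally have 1: "norm (?G (2 * (2 * Z)) \<theta>) \<le> 16 / 5 * (8 * (7 / 2) ^ K - 8)" by simp
  have 2: "norm (\<Sum>i<W. tm (2 * (2 * Z) + i) * ee (of_nat (2 * (2 * Z) + i) * \<theta>)) \<le> 3"
    using W(2) by (intro order_trans[OF norm_sum]) (simp add: norm_mult)
  have "norm (?G Y \<theta>) \<le> 16 / 5 * (8 * (7 / 2) ^ K - 8) + 3"
    unfolding W(1) sum_lessThan_add by (rule order_trans[OF norm_triangle_ineq add_mono[OF 1 2]])
  also have "\<dots> \<le> 8 * (7 / 2) ^ Suc K - 8"
  proof -
    have "16 / 5 * (8 * A - 8) + 3 \<le> 8 * (7 / 2 * A) - 8" if "0 \<le> A" for A :: real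
      using that by (simp add: field_simps)
    then show ?thesis unfolding power_Suc by simp
  qed
  finally show ?case .
qed simp

subsection \<open>Equidistributed sums of the geometric sum kernel\<close>

text \<open>
  Up to constants this is \<open>min M (1 / \<bar>sin (\<pi> y)\<bar>)\<close>, in a form that has no junk value at integers.
\<close>

definition gkernel :: "real \<Rightarrow> real \<Rightarrow> real" where
  "gkernel M y = 2 * M / (1 + M * \<bar>sin (pi * y)\<bar>)"

lemma gkernel_nonneg [simp]: "0 \<le> M \<Longrightarrow> 0 \<le> gkernel M y"
  by (simp add: gkernel_def)

lemma gkernel_le: "0 \<le> M \<Longrightarrow> gkernel M y \<le> 2 * M"
  using divide_left_mono[of 1 "1 + M * \<bar>sin (pi * y)\<bar>" "2 * M"]
  by (simp add: gkernel_def add_pos_nonneg)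

lemma gkernel_add_int: "gkernel M (y + of_int z) = gkernel M y"
  by (simp only: gkernel_def abs_sin_pi_add_int)

text \<open>The trivial bound \<open>norm S \<le> L\<close> and \<open>L\<close> times the
  telescoped bound \<open>norm S * s \<le> 1\<close> are added, so no division by a vanishing sine
  occurs. Only the length of the interval enters, so its endpoints may later depend on
  \<open>n\<close>.\<close>

lemma norm_geometric_le_gkernel:
  assumes "b \<le> a + L"
  shows "norm (\<Sum>m\<in>{a..<b}. ee (of_nat m * y)) \<le> gkernel (of_nat L) y"
proof -
  define S where "S = (\<Sum>m\<in>{a..<b}. ee (of_nat m * y))"
  define s where "s = \<bar>sin (pi * y)\<bar>"
  have L: "norm S \<le> L"
    unfolding S_def using assms by (intro order_trans[OF norm_sum]) simp
  have "norm S * s \<le> 1"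
  proof (cases "a \<le> b")
    case True
    have "ee (of_nat b * y) - ee (of_nat a * y) = (\<Sum>m\<in>{a..<b}. ee (of_nat (Suc m) * y) - ee (of_nat m * y))"
      using sum_Suc_diff'[OF True, of "\<lambda>m. ee (of_nat m * y)"] by simp
    also have "\<dots> = (ee y - 1) * S"
      unfolding S_def sum_distrib_left
      by (intro sum.cong) (simp_all add: distrib_right ee_add algebra_simps)
    finally have "norm (ee (of_nat b * y) - ee (of_nat a * y)) = 2 * s * norm S"
      by (simp add: norm_mult norm_1_minus_ee norm_minus_commute[of _ 1] s_def)
    moreover have "norm (ee (of_nat b * y) - ee (of_nat a * y)) \<le> 2"
      using norm_triangle_ineq4[of "ee (of_nat b * y)" "ee (of_nat a * y)"] by simp
    ultimately show ?thesis by (simp add: mult_ac)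
  qed (simp add: S_def)
  then have "real L * (norm S * s) \<le> real L * 1" by (intro mult_left_mono) auto
  then have "norm S * (1 + real L * s) \<le> 2 * real L"
    using L by (simp add: algebra_simps)
  moreover have "0 < 1 + real L * s" by (intro add_pos_nonneg) (auto simp: s_def)
  ultimately show ?thesis
    by (simp add: gkernel_def s_def[symmetric] S_def[symmetric] pos_le_divide_eq)
qed

lemma abs_sin_nat_mult_le: "\<bar>sin (of_nat n * x)\<bar> \<le> of_nat n * \<bar>sin x\<bar>" for x :: real
proof (induction n)
  case (Suc n)
  have "\<bar>sin (of_nat n * x) * cos x + cos (of_nat n * x) * sin x\<bar>
      \<le> \<bar>sin (of_nat n * x)\<bar> * \<bar>cos x\<bar> + \<bar>cos (of_nat n * x)\<bar> * \<bar>sin x\<bar>"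
    by (simp flip: abs_mult)
  also have "\<dots> \<le> (of_nat n * \<bar>sin x\<bar>) * 1 + 1 * \<bar>sin x\<bar>"
    by (intro add_mono mult_mono Suc.IH) auto
  finally show ?case by (simp add: sin_add algebra_simps)
qed simp

section \<open>Periodic sums over residue systems and equally spaced points\<close>

lemma sum_periodic_residues:
  fixes g :: "int \<Rightarrow> 'a :: comm_monoid_add"
  assumes q: "q > 0" and co: "coprime l (int q)" and per: "\<And>j. g (j mod int q) = g j"
  shows "(\<Sum>j<q. g (z + l * int j)) = (\<Sum>j<q. g (int j))"
proof -
  define p where "p j = nat ((z + l * int j) mod int q)" for j :: nat
  have p: "int (p j) = (z + l * int j) mod int q" for j
    using q by (simp add: p_def)
  have "inj_on p {..<q}"
  proof (rule inj_onI)
    fix i j assume ij: "i \<in> {..<q}" "j \<in> {..<q}" and "p i = p j"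
    then have "(z + l * int i) mod int q = (z + l * int j) mod int q" by (simp flip: p)
    then have "int q dvd (z + l * int i) - (z + l * int j)" by (simp add: mod_eq_dvd_iff)
    then have "int q dvd l * (int i - int j)" by (simp add: algebra_simps)
    then have "int q dvd int i - int j"
      using co by (simp add: coprime_dvd_mult_right_iff coprime_commute)
    then have "int i mod int q = int j mod int q" by (simp add: mod_eq_dvd_iff)
    then show "i = j" using ij by simp
  qed
  moreover have "p ` {..<q} \<subseteq> {..<q}"
  proof safe
    fix j
    have "int (p j) < int q" unfolding p using q by simp
    then show "p j < q" by simp
  qed
  ultimately have "bij_betw p {..<q} {..<q}"
    by (simp add: bij_betw_def endo_inj_surj)
  then have "(\<Sum>j<q. g (int j)) = (\<Sum>j<q. g (int (p j)))"
    by (rule sum.reindex_bij_betw[symmetric])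
  then show ?thesis by (simp add: p per)
qed

lemma sum_periodic_blocks:
  fixes g :: "nat \<Rightarrow> 'a :: comm_semiring_1"
  assumes "\<And>n. g (q + n) = g n"
  shows "(\<Sum>n<c * q. g n) = of_nat c * (\<Sum>n<q. g n)"
proof (induction c)
  case (Suc c)
  have "(\<Sum>n<Suc c * q. g n) = (\<Sum>n<q. g n) + (\<Sum>n<c * q. g (q + n))"
    by (simp only: mult_Suc sum_lessThan_add)
  then show ?case by (simp add: assms Suc.IH distrib_right)
qed simp

text \<open>As \<open>l\<close> is invertible modulo \<open>q\<close>, each block of
  \<open>q\<close> consecutive \<open>n\<close> meets every fraction \<open>j / q\<close> once
  modulo 1.\<close>

lemma sum_unit_periodic_progression:
  fixes \<phi> :: "real \<Rightarrow> real"
  assumes per: "\<And>y z. \<phi> (y + of_int z) = \<phi> y"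
    and q: "q > 0" and co: "coprime l (int q)"
  shows "(\<Sum>n<c * q. \<phi> (of_int l * of_nat n / of_nat q + \<theta>)) =
         of_nat c * (\<Sum>j<q. \<phi> (of_nat j / of_nat q + \<theta>))"
proof -
  define g where "g j = \<phi> (of_int j / of_nat q + \<theta>)" for j :: int
  have g: "g (j mod int q) = g j" for j
  proof -
    have "of_int j = of_int (j mod int q) + of_nat q * real_of_int (j div int q)"
      by (metis mod_mult_div_eq of_int_add of_int_mult of_int_of_nat_eq)
    then have "of_int j / of_nat q + \<theta> = (of_int (j mod int q) / of_nat q + \<theta>) + real_of_int (j div int q)"
      using q by (simp add: field_simps)
    then show ?thesis by (simp only: g_def per)
  qed
  have "(\<Sum>n<c * q. g (0 + l * int n)) = of_nat c * (\<Sum>n<q. g (0 + l * int n))"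
  proof (rule sum_periodic_blocks)
    fix n
    have "(0 + l * int (q + n)) mod int q = (0 + l * int n) mod int q"
      by (simp add: distrib_left)
    then show "g (0 + l * int (q + n)) = g (0 + l * int n)" by (metis g)
  qed
  also have "(\<Sum>n<q. g (0 + l * int n)) = (\<Sum>j<q. g (int j))"
    by (rule sum_periodic_residues[where g = g, OF q co g])
  finally show ?thesis by (simp add: g_def)
qed

lemma sum_unit_periodic_shift:
  fixes \<phi> :: "real \<Rightarrow> real"
  assumes per: "\<And>y z. \<phi> (y + of_int z) = \<phi> y" and q: "q > 0"
  shows "(\<Sum>j<q. \<phi> ((of_nat j + (t + of_int z)) / of_nat q)) = (\<Sum>j<q. \<phi> ((of_nat j + t) / of_nat q))"
proof -
  define g where "g j = \<phi> ((of_int j + t) / of_nat q)" for j :: int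
  have g: "g (j mod int q) = g j" for j
  proof -
    have "of_int j = of_int (j mod int q) + of_nat q * real_of_int (j div int q)"
      by (metis mod_mult_div_eq of_int_add of_int_mult of_int_of_nat_eq)
    then have "(of_int j + t) / of_nat q = (of_int (j mod int q) + t) / of_nat q + real_of_int (j div int q)"
      using q by (simp add: field_simps)
    then show ?thesis by (simp only: g_def per)
  qed
  show ?thesis
    using sum_periodic_residues[where g = g and l = 1 and z = z, OF q _ g] by (simp add: g_def add_ac)
qed

text \<open>Concavity keeps the sine above its chord from 0 to \<open>pi / 2\<close>; reflection
  handles the other half.\<close>

lemma sin_pi_ge:
  assumes "0 \<le> y" "y \<le> 1"
  shows "sin (pi * y) \<ge> 2 * min y (1 - y)"
proof -
  have conc: "concave_on {0..pi} sin"
    by (rule f''_le0_imp_concave[where f' = cos and f'' = "\<lambda>x. - sin x"])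
       (auto intro!: derivative_eq_intros sin_ge_zero)
  have *: "sin (pi * y) \<ge> 2 * y" if "0 \<le> y" "y \<le> 1 / 2" for y
    using concave_onD[OF conc, of "2 * y" 0 "pi / 2"] that by (simp add: mult_ac)
  show ?thesis
  proof (cases "y \<le> 1 / 2")
    case False
    have "sin (pi * y) = sin (pi * (1 - y))" by (simp add: right_diff_distrib)
    then show ?thesis using *[of "1 - y"] False assms by (simp add: min_def)
  qed (use * assms in \<open>auto simp: min_def\<close>)
qed

text \<open>Only the nearer integer matters, but adding both reciprocals lets the two ends of a grid
  be summed separately, one of them after reversal.\<close>

lemma gkernel_le_inverse:
  assumes M: "0 \<le> M" and y: "0 < y" "y < 1"
  shows "gkernel M y \<le> 1 / y + 1 / (1 - y)"
proof -
  define m where "m = min y (1 - y)"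
  have m: "0 < m" "2 * m \<le> \<bar>sin (pi * y)\<bar>"
    using y sin_pi_ge[of y] by (auto simp: m_def)
  have "2 * M * m \<le> M * \<bar>sin (pi * y)\<bar>"
    using mult_left_mono[OF m(2) M] by simp
  moreover have "0 < 1 + M * \<bar>sin (pi * y)\<bar>"
    using M by (intro add_pos_nonneg) auto
  ultimately have "gkernel M y \<le> 1 / m"
    using m(1) by (simp add: gkernel_def divide_simps)
  also have "1 / m \<le> 1 / y + 1 / (1 - y)"
    using y by (auto simp: m_def min_def)
  finally show ?thesis .
qed

text \<open>The summand at \<open>0\<close> is the junk value \<open>1 / 0 = 0\<close>.\<close>

lemma sum_inverse_le: "(\<Sum>j<2 ^ k. 1 / real j) \<le> real k"
proof (induction k)
  case (Suc k)
  have "(\<Sum>j<2 ^ Suc k. 1 / real j) = (\<Sum>j<2 ^ k. 1 / real j) + (\<Sum>j<2 ^ k. 1 / real (2 ^ k + j))"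
    by (simp only: power_Suc mult_2 sum_lessThan_add)
  also have "(\<Sum>j<2 ^ k. 1 / real (2 ^ k + j)) \<le> (\<Sum>j<(2::nat) ^ k. 1 / 2 ^ k)"
    by (intro sum_mono divide_left_mono) (auto intro!: mult_pos_pos add_pos_nonneg)
  finally show ?case using Suc.IH by simp
qed simp

text \<open>
  Only the two points next to an integer are not controlled by the harmonic sum; for these
  \<open>\<bar>sin (\<pi> t)\<bar> \<le> q \<bar>sin (\<pi> (j + t) / q)\<bar>\<close> compares the kernel with the one on the right.
\<close>

lemma gkernel_sum_le:
  fixes k :: nat
  assumes M: "0 \<le> M"
  shows "(\<Sum>j<2 ^ k. gkernel M ((of_nat j + t) / 2 ^ k)) \<le> 2 * 2 ^ k * gkernel (M / 2 ^ k) t + 2 * 2 ^ k * real k"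
proof -
  define q :: nat where "q = 2 ^ k"
  have q: "q > 0" by (simp add: q_def)
  have *: "(\<Sum>j<q. gkernel M ((of_nat j + t) / q)) \<le> 2 * q * gkernel (M / q) t + 2 * q * (\<Sum>j<q. 1 / real j)"
    if t: "0 \<le> t" "t < 1" for t
  proof -
    define B where "B = q * gkernel (M / q) t"
    have B: "0 \<le> B" using M by (simp add: B_def)
    \<comment> \<open>Each harmonic term equals \<open>1 / 0 = 0\<close> at the index where it would
      blow up, hence the separate allowance \<open>B\<close> there; for \<open>q = 1\<close> both
      allowances fall on the same index.\<close>
    have "gkernel M ((of_nat j + t) / q) \<le> (if j = 0 then B else 0) + (if j = q - 1 then B else 0)
        + q * (1 / real j) + q * (1 / real (q - Suc j))" if j: "j < q" for j
    proof -
      define y where "y = (of_nat j + t) / q"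
      have "\<bar>sin (pi * t)\<bar> = \<bar>sin (pi * (t + of_int (int j)))\<bar>" by (simp only: abs_sin_pi_add_int)
      also have "pi * (t + of_int (int j)) = of_nat q * (pi * y)" using q by (simp add: y_def field_simps)
      also have "\<bar>sin \<dots>\<bar> \<le> of_nat q * \<bar>sin (pi * y)\<bar>" by (rule abs_sin_nat_mult_le)
      finally have "M / q * \<bar>sin (pi * t)\<bar> \<le> M / q * (q * \<bar>sin (pi * y)\<bar>)"
        using M by (intro mult_left_mono) auto
      then have "M / q * \<bar>sin (pi * t)\<bar> \<le> M * \<bar>sin (pi * y)\<bar>" using q by simp
      moreover have "0 < 1 + M / q * \<bar>sin (pi * t)\<bar>"
        using M by (intro add_pos_nonneg) auto
      ultimately have "gkernel M y \<le> 2 * M / (1 + M / q * \<bar>sin (pi * t)\<bar>)"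
        unfolding gkernel_def using M by (intro divide_left_mono) auto
      also have "\<dots> = B" using q by (simp add: B_def gkernel_def)
      finally have 1: "gkernel M y \<le> B" .
      show ?thesis
      proof (cases "j = 0 \<or> j = q - 1")
        case True
        moreover have "0 \<le> q * (1 / real j)" "0 \<le> q * (1 / real (q - Suc j))" by auto
        ultimately show ?thesis using 1 B unfolding y_def[symmetric] by (smt (verit))
      next
        case False
        then have j': "0 < j" "Suc j < q" using j by auto
        then have y: "0 < y" "y < 1" using t q by (auto simp: y_def)
        have "1 / y \<le> q * (1 / real j)"
          using j' t q by (simp add: y_def frac_le)
        moreover have "1 - y = (real q - real j - t) / q" using q by (simp add: y_def field_simps)
        then have "1 / (1 - y) \<le> q * (1 / real (q - Suc j))"
          using j' t q by (simp add: of_nat_diff frac_le)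
        ultimately show ?thesis
          using gkernel_le_inverse[OF M y] False by (simp add: y_def[symmetric])
      qed
    qed
    then have "(\<Sum>j<q. gkernel M ((of_nat j + t) / q)) \<le> (\<Sum>j<q. (if j = 0 then B else 0) + (if j = q - 1 then B else 0)
        + q * (1 / real j) + q * (1 / real (q - Suc j)))"
      by (intro sum_mono) auto
    also have "\<dots> = B + B + q * (\<Sum>j<q. 1 / real j) + q * (\<Sum>j<q. 1 / real (q - Suc j))"
      using q by (simp only: sum.distrib sum_distrib_left[symmetric]) simp
    also have "(\<Sum>j<q. 1 / real (q - Suc j)) = (\<Sum>j<q. 1 / real j)"
      by (rule sum.nat_diff_reindex)
    finally show ?thesis by (simp add: B_def)
  qed
  \<comment> \<open>Passing to the fractional part only permutes the grid modulo 1 and leaves the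
    kernel on the right unchanged.\<close>
  have f: "t = frac t + of_int \<lfloor>t\<rfloor>" by (simp add: frac_def)
  have "(\<Sum>j<q. gkernel M ((of_nat j + t) / q)) = (\<Sum>j<q. gkernel M ((of_nat j + (frac t + of_int \<lfloor>t\<rfloor>)) / q))"
    by (simp only: f[symmetric])
  also have "\<dots> = (\<Sum>j<q. gkernel M ((of_nat j + frac t) / q))"
    by (rule sum_unit_periodic_shift[OF gkernel_add_int q])
  also have "\<dots> \<le> 2 * q * gkernel (M / q) (frac t) + 2 * q * (\<Sum>j<q. 1 / real j)"
    by (intro * frac_ge_0 frac_lt_1)
  also have "gkernel (M / q) (frac t) = gkernel (M / q) t"
    using gkernel_add_int[of "M / q" "frac t" "\<lfloor>t\<rfloor>"] by (simp only: f[symmetric])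
  also have "2 * q * gkernel (M / q) t + 2 * q * (\<Sum>j<q. 1 / real j) \<le> 2 * q * gkernel (M / q) t + 2 * q * real k"
    unfolding q_def by (intro add_left_mono mult_left_mono sum_inverse_le) simp
  finally show ?thesis by (simp add: q_def)
qed

subsection \<open>Correlations of the truncated sequence\<close>

lemma sum_ee_fraction:
  assumes Q: "Q > 0"
  shows "(\<Sum>h<Q. ee (of_nat h * (of_int z / of_nat Q))) = (if int Q dvd z then of_nat Q else 0)"
proof (cases "int Q dvd z")
  case True
  then obtain w where "z = int Q * w" by blast
  then have "of_nat h * (real_of_int z / of_nat Q) = of_int (int h * w)" for h
    using Q by simp
  then have "ee (of_nat h * (of_int z / of_nat Q)) = 1" for h
    by (metis ee_int)
  then show ?thesis using True by simp
next
  case False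
  define x where "x = ee (of_int z / of_nat Q)"
  have "x \<noteq> 1"
  proof
    assume "x = 1"
    then obtain i :: int where "pi * (of_int z / of_nat Q) = of_int i * pi"
      by (auto simp: x_def ee_eq_1_iff sin_zero_iff_int2)
    then have "real_of_int z = of_int (i * int Q)" using Q by (simp add: field_simps)
    then show False using False by (metis dvd_triv_right of_int_eq_iff)
  qed
  moreover have "x ^ Q = 1"
    using Q ee_int[of z] by (simp add: x_def ee_power)
  ultimately have "(\<Sum>h<Q. x ^ h) = 0" by (simp add: geometric_sum)
  then show ?thesis using False by (simp add: x_def ee_power)
qed

lemma sum_swap_right:
  "(\<Sum>x\<in>A. \<Sum>y\<in>B. \<Sum>z\<in>C. f x y z) = (\<Sum>y\<in>B. \<Sum>z\<in>C. \<Sum>x\<in>A. f x y z)"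
  for f :: "'a \<Rightarrow> 'b \<Rightarrow> 'c \<Rightarrow> 'd :: comm_monoid_add"
proof -
  have "(\<Sum>x\<in>A. \<Sum>y\<in>B. \<Sum>z\<in>C. f x y z) = (\<Sum>y\<in>B. \<Sum>x\<in>A. \<Sum>z\<in>C. f x y z)"
    by (rule sum.swap)
  also have "\<dots> = (\<Sum>y\<in>B. \<Sum>z\<in>C. \<Sum>x\<in>A. f x y z)"
    by (rule sum.cong[OF refl]) (rule sum.swap)
  finally show ?thesis .
qed

definition fcoeff :: "nat \<Rightarrow> nat \<Rightarrow> complex" where
  "fcoeff l h = (\<Sum>v<2 ^ l. tm v * ee (of_nat v * (of_nat h / 2 ^ l))) / 2 ^ l"

lemma norm_fcoeff: "norm (fcoeff l h) = sin_prod l (of_nat h / 2 ^ l)"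
  by (simp only: fcoeff_def norm_divide norm_tm_poly norm_power norm_numeral) simp

lemma tm_mod_fourier:
  "tm (u mod 2 ^ l) = (\<Sum>h<2 ^ l. fcoeff l h * ee (- (of_nat u * (of_nat h / 2 ^ l))))"
proof -
  define Q :: nat where "Q = 2 ^ l"
  have Q: "Q > 0" by (simp add: Q_def)
  have "(\<Sum>h<Q. fcoeff l h * ee (- (of_nat u * (of_nat h / Q)))) =
        (\<Sum>h<Q. \<Sum>v<Q. tm v / Q * ee (of_nat h * (of_int (int v - int u) / Q)))"
  proof (intro sum.cong refl)
    fix h
    have "ee (of_nat h * (of_int (int v - int u) / Q)) = ee (of_nat v * (of_nat h / Q)) * ee (- (of_nat u * (of_nat h / Q)))" for v
      by (simp flip: ee_add add: diff_divide_distrib algebra_simps)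
    then show "fcoeff l h * ee (- (of_nat u * (of_nat h / Q))) = (\<Sum>v<Q. tm v / Q * ee (of_nat h * (of_int (int v - int u) / Q)))"
      by (simp add: fcoeff_def Q_def sum_distrib_right sum_divide_distrib mult.assoc)
  qed
  also have "\<dots> = (\<Sum>v<Q. tm v / Q * (\<Sum>h<Q. ee (of_nat h * (of_int (int v - int u) / Q))))"
    by (subst sum.swap) (simp only: sum_distrib_left)
  also have "\<dots> = (\<Sum>v<Q. if v = u mod Q then tm v else 0)"
  proof (intro sum.cong refl)
    fix v assume v: "v \<in> {..<Q}"
    have "int Q dvd int v - int u \<longleftrightarrow> v = u mod Q"
    proof -
      have "int Q dvd int v - int u \<longleftrightarrow> int v mod int Q = int u mod int Q" by (simp add: mod_eq_dvd_iff)
      also have "\<dots> \<longleftrightarrow> v mod Q = u mod Q" by (metis of_nat_mod of_nat_eq_iff)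
      finally show ?thesis using v by simp
    qed
    then show "tm v / Q * (\<Sum>h<Q. ee (of_nat h * (of_int (int v - int u) / Q))) = (if v = u mod Q then tm v else 0)"
      unfolding sum_ee_fraction[OF Q] using Q by simp
  qed
  also have "\<dots> = tm (u mod Q)" using Q by simp
  finally show ?thesis by (simp add: Q_def)
qed

text \<open>Conjugating the expansion of a real value reverses its phases. Using one version for
  each factor of a correlation makes differences of frequencies appear.\<close>

lemma tm_mod_fourier_cnj:
  "tm (u mod 2 ^ l) = (\<Sum>h<2 ^ l. cnj (fcoeff l h) * ee (of_nat u * (of_nat h / 2 ^ l)))"
proof -
  have "tm (u mod 2 ^ l) = cnj (tm (u mod 2 ^ l))" by simp
  also have "\<dots> = (\<Sum>h<2 ^ l. cnj (fcoeff l h) * ee (of_nat u * (of_nat h / 2 ^ l)))"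
    unfolding tm_mod_fourier by (simp add: cnj_sum flip: ee_minus)
  finally show ?thesis .
qed

text \<open>Once both factors are expanded, the phase is linear in \<open>m\<close>, so the sum over
  \<open>m\<close> is geometric. Its slope contains \<open>h - k\<close> multiplied by
  \<open>n\<close>, which is what the later average over \<open>n\<close> exploits.\<close>

lemma norm_truncated_correlation_le:
  assumes "b \<le> a + L"
  shows "norm (\<Sum>m\<in>{a..<b}. tm ((m * (n + r)) mod 2 ^ l) * tm ((m * n) mod 2 ^ l) * ee (of_nat m * \<beta>))
    \<le> (\<Sum>h<2 ^ l. \<Sum>k<2 ^ l. sin_prod l (of_nat h / 2 ^ l) * sin_prod l (of_nat k / 2 ^ l) *
          gkernel (of_nat L) (of_int (int h - int k) * of_nat n / 2 ^ l + (of_nat (h * r) / 2 ^ l + \<beta>)))"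
proof -
  define y where "y h k = of_int (int h - int k) * of_nat n / 2 ^ l + (of_nat (h * r) / 2 ^ l + \<beta>)" for h k :: nat
  have *: "tm ((m * (n + r)) mod 2 ^ l) * tm ((m * n) mod 2 ^ l) * ee (of_nat m * \<beta>) =
        (\<Sum>h<2 ^ l. \<Sum>k<2 ^ l. cnj (fcoeff l h) * fcoeff l k * ee (of_nat m * y h k))" for m
  proof -
    have "of_nat m * y h k = of_nat (m * (n + r)) * (of_nat h / 2 ^ l) + - (of_nat (m * n) * (of_nat k / 2 ^ l)) + of_nat m * \<beta>" for h k
      by (simp add: y_def field_simps)
    then have "ee (of_nat m * y h k) = ee (of_nat (m * (n + r)) * (of_nat h / 2 ^ l)) * ee (- (of_nat (m * n) * (of_nat k / 2 ^ l))) * ee (of_nat m * \<beta>)" for h k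
      by (simp only: ee_add)
    moreover have "tm ((m * (n + r)) mod 2 ^ l) * tm ((m * n) mod 2 ^ l) =
        (\<Sum>h<2 ^ l. \<Sum>k<2 ^ l. (cnj (fcoeff l h) * ee (of_nat (m * (n + r)) * (of_nat h / 2 ^ l))) *
           (fcoeff l k * ee (- (of_nat (m * n) * (of_nat k / 2 ^ l)))))"
      unfolding tm_mod_fourier[of "m * n"] tm_mod_fourier_cnj[of "m * (n + r)"] by (rule sum_product)
    ultimately show ?thesis by (simp only: sum_distrib_left mult_ac)
  qed
  have eq: "(\<Sum>m\<in>{a..<b}. tm ((m * (n + r)) mod 2 ^ l) * tm ((m * n) mod 2 ^ l) * ee (of_nat m * \<beta>))
      = (\<Sum>h<2 ^ l. \<Sum>k<2 ^ l. cnj (fcoeff l h) * fcoeff l k * (\<Sum>m\<in>{a..<b}. ee (of_nat m * y h k)))"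
    unfolding * sum_distrib_left
    by (rule sum_swap_right)
  have "norm (\<Sum>h<2 ^ l. \<Sum>k<2 ^ l. cnj (fcoeff l h) * fcoeff l k * (\<Sum>m\<in>{a..<b}. ee (of_nat m * y h k))) \<le> (\<Sum>h<2 ^ l. \<Sum>k<2 ^ l. sin_prod l (of_nat h / 2 ^ l) * sin_prod l (of_nat k / 2 ^ l) * gkernel (of_nat L) (y h k))"
    by (intro order_trans[OF norm_sum] sum_mono)
       (auto simp: norm_mult norm_fcoeff intro!: mult_left_mono norm_geometric_le_gkernel assms)
  then show ?thesis by (simp only: eq y_def)
qed

text \<open>
  The exact divisor is \<open>2\<^sup>d = gcd (h - k, 2\<^sup>l)\<close>. Summing instead over all powers of two that
  divide \<open>h - k\<close> loses little and makes the bound additive in \<open>d\<close>.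
\<close>

lemma gkernel_progression_sum_le:
  fixes h k :: nat
  assumes M: "0 \<le> M" and l: "l \<le> \<nu>"
  shows "(\<Sum>n<2 ^ \<nu>. gkernel M (of_int (int h - int k) * of_nat n / 2 ^ l + (of_nat (h * r) / 2 ^ l + \<beta>)))
    \<le> 2 * 2 ^ \<nu> * real l + (\<Sum>d\<le>l. if 2 ^ d dvd int h - int k
         then 2 * 2 ^ \<nu> * gkernel (M / 2 ^ (l - d)) (of_nat (h * r) / 2 ^ d + 2 ^ (l - d) * \<beta>) else 0)"
proof -
  define z where "z = int h - int k"
  define \<theta> where "\<theta> = of_nat (h * r) / 2 ^ l + \<beta>"
  have "gcd z (2 ^ l) dvd 2 ^ l" by simp
  then obtain d where d: "d \<le> l" "normalize (gcd z (2 ^ l)) = normalize (2 ^ d)"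
    using divides_primepow[of "2 :: int" "gcd z (2 ^ l)" l] by auto
  then have g: "gcd z (2 ^ l) = 2 ^ d" by simp
  then have dz: "2 ^ d dvd z" by (metis gcd_dvd1)
  define z' where "z' = z div 2 ^ d"
  have z': "z = 2 ^ d * z'" using dz by (simp add: z'_def)
  have l_eq: "l = d + (l - d)" using d by simp
  have co: "coprime z' (int (2 ^ (l - d)))"
  proof -
    have "(2 ^ l :: int) = 2 ^ d * 2 ^ (l - d)" using d by (simp flip: power_add)
    then have "2 ^ d * gcd z' (2 ^ (l - d)) = (2 ^ d :: int)"
      using g by (simp add: z' gcd_mult_left)
    then show ?thesis by (simp add: coprime_iff_gcd_eq_1)
  qed
  have pw: "(2::real) ^ l = 2 ^ d * 2 ^ (l - d)" using d by (simp flip: power_add)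
  \<comment> \<open>Since \<open>l \<le> \<nu>\<close>, the range of \<open>n\<close> consists of
    whole periods of the reduced modulus \<open>2 ^ (l - d)\<close>.\<close>
  have \<nu>: "(2::nat) ^ \<nu> = 2 ^ (\<nu> - (l - d)) * 2 ^ (l - d)" using d l by (simp flip: power_add)
  have \<nu>': "(2::real) ^ \<nu> = 2 ^ (\<nu> - (l - d)) * 2 ^ (l - d)" using d l by (simp flip: power_add)
  have t: "2 ^ (l - d) * \<theta> = of_nat (h * r) / 2 ^ d + 2 ^ (l - d) * \<beta>"
    by (simp add: \<theta>_def pw distrib_left)
  have "(\<Sum>n<2 ^ \<nu>. gkernel M (of_int z * of_nat n / 2 ^ l + \<theta>))
     = (\<Sum>n<2 ^ (\<nu> - (l - d)) * 2 ^ (l - d). gkernel M (of_int z' * of_nat n / of_nat (2 ^ (l - d)) + \<theta>))"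
    unfolding \<nu> by (intro sum.cong refl) (simp add: z' pw)
  also have "\<dots> = of_nat (2 ^ (\<nu> - (l - d))) * (\<Sum>j<2 ^ (l - d). gkernel M (of_nat j / of_nat (2 ^ (l - d)) + \<theta>))"
    by (rule sum_unit_periodic_progression[where \<phi> = "gkernel M", OF gkernel_add_int _ co]) simp
  also have "(\<Sum>j<2 ^ (l - d). gkernel M (of_nat j / of_nat (2 ^ (l - d)) + \<theta>))
     = (\<Sum>j<2 ^ (l - d). gkernel M ((of_nat j + 2 ^ (l - d) * \<theta>) / 2 ^ (l - d)))"
    by (simp add: add_divide_distrib)
  also have "of_nat (2 ^ (\<nu> - (l - d))) * \<dots> \<le> of_nat (2 ^ (\<nu> - (l - d))) *
      (2 * 2 ^ (l - d) * gkernel (M / 2 ^ (l - d)) (2 ^ (l - d) * \<theta>) + 2 * 2 ^ (l - d) * real (l - d))"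
    by (intro mult_left_mono gkernel_sum_le M) auto
  also have "\<dots> = 2 * 2 ^ \<nu> * gkernel (M / 2 ^ (l - d)) (2 ^ (l - d) * \<theta>) + 2 * 2 ^ \<nu> * real (l - d)"
    by (simp add: \<nu>' algebra_simps)
  also have "\<dots> \<le> (\<Sum>d\<le>l. if 2 ^ d dvd z
         then 2 * 2 ^ \<nu> * gkernel (M / 2 ^ (l - d)) (of_nat (h * r) / 2 ^ d + 2 ^ (l - d) * \<beta>) else 0) + 2 * 2 ^ \<nu> * real l"
  proof (intro add_mono)
    show "2 * 2 ^ \<nu> * gkernel (M / 2 ^ (l - d)) (2 ^ (l - d) * \<theta>) \<le> (\<Sum>d\<le>l. if 2 ^ d dvd z
         then 2 * 2 ^ \<nu> * gkernel (M / 2 ^ (l - d)) (of_nat (h * r) / 2 ^ d + 2 ^ (l - d) * \<beta>) else 0)"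
      unfolding t using d dz M
      by (intro order_trans[OF _ member_le_sum[of d]]) auto
  qed auto
  finally show ?thesis by (simp add: z_def \<theta>_def)
qed

lemma sum_lessThan_mult:
  fixes f :: "nat \<Rightarrow> 'a :: comm_monoid_add"
  shows "(\<Sum>i<d * q. f i) = (\<Sum>a<d. \<Sum>b<q. f (a + d * b))"
proof (induction q)
  case (Suc q)
  have "(\<Sum>i<d * Suc q. f i) = (\<Sum>i<d * q. f i) + (\<Sum>i<d. f (i + d * q))"
    by (simp only: mult_Suc_right add.commute[of d] sum_lessThan_add) (simp add: add.commute)
  then show ?case by (simp add: Suc.IH sum.distrib)
qed simp

text \<open>The last \<open>d\<close> factors depend only on the frequency modulo
  \<open>2 ^ d\<close>, hence only on \<open>a\<close>. The first \<open>l - d\<close> factors run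
  over a full translated grid, where the first moment bound applies.\<close>

lemma sin_prod_coset_sum_le:
  assumes "d \<le> l"
  shows "(\<Sum>b<2 ^ (l - d). sin_prod l (of_nat (a + 2 ^ d * b) / 2 ^ l))
     \<le> sin_prod d (of_nat a / 2 ^ d) * sqrt (2 * (37 / 20) ^ (l - d))"
proof -
  have pw: "(2::real) ^ l = 2 ^ d * 2 ^ (l - d)" using assms by (simp flip: power_add)
  have *: "sin_prod l (of_nat (a + 2 ^ d * b) / 2 ^ l) = sin_prod (l - d) ((of_nat b + of_nat a / 2 ^ d) / 2 ^ (l - d)) * sin_prod d (of_nat a / 2 ^ d)" for b
  proof -
    define x :: real where "x = of_nat (a + 2 ^ d * b) / 2 ^ l"
    have x1: "x = (of_nat b + of_nat a / 2 ^ d) / 2 ^ (l - d)" by (simp add: x_def pw field_simps)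
    have x2: "2 ^ (l - d) * x = of_nat a / 2 ^ d + of_nat b" by (simp add: x1)
    have "sin_prod l x = sin_prod (l - d) x * sin_prod d (2 ^ (l - d) * x)"
      using sin_prod_add[of "l - d" d x] assms by simp
    also have "sin_prod d (2 ^ (l - d) * x) = sin_prod d (of_nat a / 2 ^ d)" unfolding x2 by (rule sin_prod_add_nat)
    finally show ?thesis by (simp only: x1[symmetric]) (simp only: x_def)
  qed
  have "(\<Sum>b<2 ^ (l - d). sin_prod l (of_nat (a + 2 ^ d * b) / 2 ^ l)) =
     sin_prod d (of_nat a / 2 ^ d) * (\<Sum>b<2 ^ (l - d). sin_prod (l - d) ((of_nat b + of_nat a / 2 ^ d) / 2 ^ (l - d)))"
    by (subst mult.commute) (simp only: * sum_distrib_right)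
  also have "\<dots> \<le> sin_prod d (of_nat a / 2 ^ d) * sqrt (2 * (37 / 20) ^ (l - d))"
    by (intro mult_left_mono sin_prod_sum_le) auto
  finally show ?thesis .
qed

text \<open>Congruent frequencies share a residue \<open>a\<close>, so the double sum is a
  \<open>\<psi>\<close>-weighted sum of squared coset sums. The residue keeps its squared
  coefficient, while the other \<open>l - d\<close> digits contribute the square of a first
  moment.\<close>

lemma coset_pair_sum_le:
  fixes \<psi> :: "nat \<Rightarrow> real"
  assumes d: "d \<le> l" and \<psi>: "\<And>h. 0 \<le> \<psi> h" "\<And>a b. \<psi> (a + 2 ^ d * b) = \<psi> a"
  shows "(\<Sum>h<2 ^ l. \<Sum>k<2 ^ l. sin_prod l (of_nat h / 2 ^ l) * sin_prod l (of_nat k / 2 ^ l) * (if 2 ^ d dvd int h - int k then \<psi> h else 0))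
    \<le> 2 * (37 / 20) ^ (l - d) * (\<Sum>a<2 ^ d. (sin_prod d (of_nat a / 2 ^ d))\<^sup>2 * \<psi> a)"
proof -
  define D q :: nat where "D = 2 ^ d" and "q = 2 ^ (l - d)"
  define p where "p h = sin_prod l (of_nat h / 2 ^ l)" for h :: nat
  have Dq: "2 ^ l = D * q" using d by (simp add: D_def q_def flip: power_add)
  have cong: "2 ^ d dvd int (a + D * b) - int (a' + D * b') \<longleftrightarrow> a' = a" if "a < D" "a' < D" for a a' b b'
  proof -
    have "int (a + D * b) - int (a' + D * b') = (int a - int a') + int D * (int b - int b')"
      by (simp add: algebra_simps)
    moreover have "2 ^ d = int D" by (simp add: D_def)
    ultimately have "2 ^ d dvd int (a + D * b) - int (a' + D * b') \<longleftrightarrow> int D dvd int a - int a'"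
      by (simp only: dvd_add_left_iff[OF dvd_triv_left])
    also have "\<dots> \<longleftrightarrow> int a mod int D = int a' mod int D" by (simp only: mod_eq_dvd_iff)
    also have "\<dots> \<longleftrightarrow> a = a'" using that by simp
    also have "\<dots> \<longleftrightarrow> a' = a" by blast
    finally show ?thesis .
  qed
  have "(\<Sum>h<2 ^ l. \<Sum>k<2 ^ l. p h * p k * (if 2 ^ d dvd int h - int k then \<psi> h else 0))
     = (\<Sum>a<D. \<Sum>b<q. \<Sum>a'<D. \<Sum>b'<q. p (a + D * b) * p (a' + D * b') * (if a' = a then \<psi> a else 0))"
    unfolding Dq sum_lessThan_mult
    by (intro sum.cong refl) (simp only: lessThan_iff cong \<psi>(2)[folded D_def])
  also have "\<dots> = (\<Sum>a<D. \<Sum>b<q. \<Sum>a'<D. if a' = a then (\<Sum>b'<q. p (a + D * b) * p (a + D * b') * \<psi> a) else 0)"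
    by (intro sum.cong refl) auto
  also have "\<dots> = (\<Sum>a<D. \<Sum>b<q. \<Sum>b'<q. p (a + D * b) * p (a + D * b') * \<psi> a)"
    by (rule sum.cong[OF refl], rule sum.cong[OF refl]) simp
  also have "\<dots> = (\<Sum>a<D. \<psi> a * (\<Sum>b<q. p (a + D * b))\<^sup>2)"
    by (simp only: power2_eq_square sum_product sum_distrib_left mult_ac)
  also have "\<dots> \<le> (\<Sum>a<D. \<psi> a * (sin_prod d (of_nat a / 2 ^ d) * sqrt (2 * (37 / 20) ^ (l - d)))\<^sup>2)"
    using sin_prod_coset_sum_le[OF d]
    by (intro sum_mono mult_left_mono \<psi> power_mono sum_nonneg) (auto simp: p_def D_def q_def)
  also have "\<dots> = 2 * (37 / 20) ^ (l - d) * (\<Sum>a<2 ^ d. (sin_prod d (of_nat a / 2 ^ d))\<^sup>2 * \<psi> a)"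
    by (simp add: power_mult_distrib sum_distrib_left D_def mult_ac)
  finally show ?thesis by (simp only: p_def)
qed

text \<open>The weights have total mass 1 by \<open>sin_prod_sum_sq\<close>, so the trivial bound
  for the kernel can be taken out.\<close>

lemma weighted_gkernel_sum_le_parseval:
  assumes "0 \<le> M"
  shows "(\<Sum>a<2 ^ d. (sin_prod d (of_nat a / 2 ^ d))\<^sup>2 * gkernel M (y a)) \<le> 2 * M"
proof -
  have "(\<Sum>a<2 ^ d. (sin_prod d (of_nat a / 2 ^ d))\<^sup>2 * gkernel M (y a)) \<le> (\<Sum>a<2 ^ d. (sin_prod d (of_nat a / 2 ^ d))\<^sup>2 * (2 * M))"
    by (intro sum_mono mult_left_mono gkernel_le assms) auto
  also have "\<dots> = 2 * M"
    using sin_prod_sum_sq[of d 0] by (simp flip: sum_distrib_right)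
  finally show ?thesis .
qed

text \<open>If \<open>2 ^ s\<close> is the common part of \<open>r\<close> and \<open>2 ^ d\<close>,
  the multiples of \<open>r\<close> fill a grid of \<open>2 ^ (d - s)\<close> points, each hit
  \<open>2 ^ s\<close> times. As \<open>2 ^ s \<le> r\<close>, this repetition costs at most the
  factor \<open>r\<close>.\<close>

lemma gkernel_multiples_sum_le:
  assumes M: "0 \<le> M" and r: "r > 0"
  shows "(\<Sum>a<2 ^ d. gkernel M (of_nat (a * r) / 2 ^ d + \<beta>)) \<le> 4 * real r * M + 2 * 2 ^ d * real d"
proof -
  have "gcd r (2 ^ d) dvd 2 ^ d" by simp
  then obtain s where s: "s \<le> d" and g: "gcd r (2 ^ d) = 2 ^ s"
    using divides_primepow_nat[of 2 "gcd r (2 ^ d)" d] by auto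
  define r' where "r' = r div 2 ^ s"
  have "2 ^ s dvd r" using g by (metis gcd_dvd1)
  then have r': "r = 2 ^ s * r'" by (simp add: r'_def)
  have "2 ^ s \<le> r" using \<open>2 ^ s dvd r\<close> r by (rule dvd_imp_le)
  then have sr: "2 ^ s \<le> real r" by (metis of_nat_le_iff of_nat_numeral of_nat_power)
  have co: "coprime (int r') (int (2 ^ (d - s)))"
  proof -
    have "(2 ^ d :: nat) = 2 ^ s * 2 ^ (d - s)" using s by (simp flip: power_add)
    then have "2 ^ s * gcd r' (2 ^ (d - s)) = (2 ^ s :: nat)"
      using g by (simp add: r' gcd_mult_left)
    then have "coprime r' (2 ^ (d - s))" by (simp add: coprime_iff_gcd_eq_1)
    then show ?thesis by simp
  qed
  have pw: "(2::real) ^ d = 2 ^ s * 2 ^ (d - s)" "(2::nat) ^ d = 2 ^ s * 2 ^ (d - s)"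
    using s by (simp_all flip: power_add)
  have "(\<Sum>a<2 ^ d. gkernel M (of_nat (a * r) / 2 ^ d + \<beta>))
      = (\<Sum>a<2 ^ s * 2 ^ (d - s). gkernel M (of_int (int r') * of_nat a / of_nat (2 ^ (d - s)) + \<beta>))"
    unfolding pw(2) by (intro sum.cong refl) (simp add: pw(1) r' mult_ac)
  also have "\<dots> = of_nat (2 ^ s) * (\<Sum>j<2 ^ (d - s). gkernel M (of_nat j / of_nat (2 ^ (d - s)) + \<beta>))"
    by (rule sum_unit_periodic_progression[where \<phi> = "gkernel M", OF gkernel_add_int _ co]) simp
  also have "(\<Sum>j<2 ^ (d - s). gkernel M (of_nat j / of_nat (2 ^ (d - s)) + \<beta>))
     = (\<Sum>j<2 ^ (d - s). gkernel M ((of_nat j + 2 ^ (d - s) * \<beta>) / 2 ^ (d - s)))"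
    by (simp add: add_divide_distrib)
  also have "\<dots> \<le> 2 * 2 ^ (d - s) * gkernel (M / 2 ^ (d - s)) (2 ^ (d - s) * \<beta>) + 2 * 2 ^ (d - s) * real (d - s)"
    by (rule gkernel_sum_le[OF M])
  also have "gkernel (M / 2 ^ (d - s)) (2 ^ (d - s) * \<beta>) \<le> 2 * (M / 2 ^ (d - s))"
    using M by (intro gkernel_le) simp
  also have "of_nat (2 ^ s) * (2 * 2 ^ (d - s) * (2 * (M / 2 ^ (d - s))) + 2 * 2 ^ (d - s) * real (d - s))
     = 4 * 2 ^ s * M + 2 * 2 ^ d * real (d - s)"
    by (simp add: pw(1) algebra_simps)
  also have "\<dots> \<le> 4 * real r * M + 2 * 2 ^ d * real d"
    using sr M by (intro add_mono mult_mono mult_left_mono) auto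
  finally show ?thesis by simp
qed

lemma min_le_sqrt_mult: "min x y \<le> sqrt (x * y)" if "0 \<le> x" "0 \<le> y" for x y :: real
proof (rule real_le_rsqrt)
  show "(min x y)\<^sup>2 \<le> x * y"
    unfolding power2_eq_square using that by (intro mult_mono) auto
qed

text \<open>The averaged kernel has a part independent of \<open>h\<close> and \<open>k\<close>,
  paid for by the squared first moment, and one part for each \<open>d\<close>, paid for by
  \<open>S\<close>. The hypothesis \<open>r * M \<le> 2 ^ l\<close> keeps
  \<open>r * M / 2 ^ (l - d)\<close> below \<open>2 ^ d\<close>, the number of residues.\<close>

lemma truncated_correlation_sum_le:
  fixes M r l \<nu> :: nat
  assumes r: "0 < r" "r * M \<le> 2 ^ l" and l: "l \<le> \<nu>" and ab: "\<And>n. b n \<le> a n + M"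
  shows "(\<Sum>n<2 ^ \<nu>. norm (\<Sum>m\<in>{a n..<b n}. tm ((m * (n + r)) mod 2 ^ l) * tm ((m * n) mod 2 ^ l) * ee (of_nat m * \<beta>)))
    \<le> 52 * 2 ^ \<nu> * 2 ^ l * (real l + 1)\<^sup>2 * sqrt ((37 / 40) ^ l)"
proof -
  define p where "p h = sin_prod l (of_nat h / 2 ^ l)" for h :: nat
  define \<psi> where "\<psi> d h = gkernel (M / 2 ^ (l - d)) (of_nat (h * r) / 2 ^ d + 2 ^ (l - d) * \<beta>)" for d h :: nat
  define g where "g h k n = gkernel M (of_int (int h - int k) * of_nat n / 2 ^ l + (of_nat (h * r) / 2 ^ l + \<beta>))" for h k n :: nat
  define s where "s = sqrt ((37 / 40 :: real) ^ l)"
  have s: "0 \<le> s" by (simp add: s_def)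
  have p0: "0 \<le> p h" for h by (simp add: p_def)
  have p_sum: "(\<Sum>h<2 ^ l. p h) \<le> sqrt (2 * (37 / 20) ^ l)"
    using sin_prod_sum_le[of l 0] by (simp add: p_def)
  have \<psi>0: "0 \<le> \<psi> d h" for d h by (simp add: \<psi>_def)
  have \<psi>_per: "\<psi> d (a + 2 ^ d * b) = \<psi> d a" for d a b
  proof -
    have "of_nat ((a + 2 ^ d * b) * r) / 2 ^ d + 2 ^ (l - d) * \<beta> = (of_nat (a * r) / 2 ^ d + 2 ^ (l - d) * \<beta>) + of_int (int (b * r))"
      by (simp add: field_simps)
    then show ?thesis by (simp only: \<psi>_def gkernel_add_int)
  qed
  \<comment> \<open>The first moment alone would save \<open>(37 / 40) ^ l\<close>; this is weakened
    to its square root \<open>s\<close>, which is all that the geometric mean in \<open>S\<close>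
    provides.\<close>
  have s2: "(37 / 20 :: real) ^ l \<le> 2 ^ l * s"
  proof -
    have "(37 / 20 :: real) ^ l = 2 ^ l * (37 / 40) ^ l" by (simp flip: power_mult_distrib)
    also have "(37 / 40 :: real) ^ l = s * s" by (simp add: s_def)
    also have "s * s \<le> s * 1" using s by (intro mult_left_mono) (auto simp: s_def power_le_one)
    finally show ?thesis by simp
  qed
  have S: "(\<Sum>h<2 ^ l. \<Sum>k<2 ^ l. p h * p k * (if 2 ^ d dvd int h - int k then \<psi> d h else 0)) \<le> 10 * 2 ^ l * (real l + 1) * s"
    if d: "d \<le> l" for d
  proof -
    define A where "A = (\<Sum>a<2 ^ d. (sin_prod d (of_nat a / 2 ^ d))\<^sup>2 * \<psi> d a)"
    have pw: "(2::real) ^ l = 2 ^ d * 2 ^ (l - d)" using d by (simp flip: power_add)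
    have M2: "real M \<le> 2 ^ l"
    proof -
      have "1 * M \<le> r * M" using r(1) by (intro mult_right_mono) auto
      from order_trans[OF this r(2)] have "M \<le> 2 ^ l" by simp
      then show ?thesis by (metis of_nat_le_iff of_nat_numeral of_nat_power)
    qed
    have rM: "real r * real M \<le> 2 ^ l"
      using r(2) by (metis of_nat_le_iff of_nat_mult of_nat_numeral of_nat_power)
    \<comment> \<open>Parseval is efficient when \<open>d\<close> is small compared to \<open>l\<close>, the uniform bound when \<open>d\<close> is close to \<open>l\<close>;
      the geometric mean covers both.\<close>
    have "A \<le> 2 * (M / 2 ^ (l - d))"
      unfolding A_def \<psi>_def by (intro weighted_gkernel_sum_le_parseval) simp
    also have "\<dots> \<le> 2 * (2 ^ l / 2 ^ (l - d))"
      using M2 by (intro mult_left_mono divide_right_mono) auto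
    finally have A1: "A \<le> 2 * 2 ^ d" by (simp add: pw)
    have "A \<le> (\<Sum>a<2 ^ d. 5 / 4 * (4 / 5) ^ d * \<psi> d a)"
      unfolding A_def by (intro sum_mono mult_right_mono sin_prod_sq_le \<psi>0)
    also have "\<dots> = 5 / 4 * (4 / 5) ^ d * (\<Sum>a<2 ^ d. \<psi> d a)" by (simp add: sum_distrib_left)
    also have "\<dots> \<le> 5 / 4 * (4 / 5) ^ d * (4 * real r * (M / 2 ^ (l - d)) + 2 * 2 ^ d * real d)"
      unfolding \<psi>_def using r by (intro mult_left_mono gkernel_multiples_sum_le) auto
    also have "4 * real r * (M / 2 ^ (l - d)) = 4 * (real r * real M / 2 ^ (l - d))" by simp
    also have "real r * real M / 2 ^ (l - d) \<le> 2 ^ l / 2 ^ (l - d)"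
      using rM by (intro divide_right_mono) auto
    also have "5 / 4 * (4 / 5) ^ d * (4 * (2 ^ l / 2 ^ (l - d)) + 2 * 2 ^ d * real d) = (4 / 5) ^ d * (2 ^ d * (5 + 5 / 2 * real d))"
      by (simp add: pw algebra_simps)
    also have "\<dots> \<le> (37 / 40) ^ d * (2 ^ d * (5 * (real l + 1)))"
      using d by (intro mult_mono power_mono) auto
    finally have A2: "A \<le> (37 / 40) ^ d * (2 ^ d * (5 * (real l + 1)))" by simp
    have "(37 / 20) ^ (l - d) * A \<le> 2 ^ l * (5 * (real l + 1)) * min ((37 / 40) ^ (l - d)) ((37 / 40) ^ d)"
    proof (cases "(37 / 40 :: real) ^ (l - d) \<le> (37 / 40) ^ d")
      case True
      have "(37 / 20 :: real) ^ (l - d) = 2 ^ (l - d) * (37 / 40) ^ (l - d)" by (simp flip: power_mult_distrib)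
      then have "(37 / 20) ^ (l - d) * A \<le> 2 ^ (l - d) * (37 / 40) ^ (l - d) * (2 ^ d * (5 * (real l + 1)))"
        by (simp only:) (intro mult_left_mono order_trans[OF A1], auto)
      then show ?thesis using True by (simp add: pw min_absorb1 mult_ac)
    next
      case False
      have "(37 / 20) ^ (l - d) * A \<le> 2 ^ (l - d) * ((37 / 40) ^ d * (2 ^ d * (5 * (real l + 1))))"
        using A2 by (intro mult_mono power_mono) (auto simp: A_def intro!: sum_nonneg mult_nonneg_nonneg \<psi>0)
      then show ?thesis using False by (simp add: pw min_absorb2 mult_ac)
    qed
    also have "min ((37 / 40) ^ (l - d)) ((37 / 40) ^ d) \<le> sqrt ((37 / 40) ^ (l - d) * (37 / 40 :: real) ^ d)"
      by (rule min_le_sqrt_mult) auto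
    also have "(37 / 40) ^ (l - d) * (37 / 40) ^ d = (37 / 40 :: real) ^ l" using d by (simp flip: power_add)
    finally have "(37 / 20) ^ (l - d) * A \<le> 2 ^ l * (5 * (real l + 1)) * s" by (simp add: s_def)
    then have "2 * (37 / 20) ^ (l - d) * A \<le> 10 * 2 ^ l * (real l + 1) * s" by (simp add: algebra_simps)
    moreover have "(\<Sum>h<2 ^ l. \<Sum>k<2 ^ l. p h * p k * (if 2 ^ d dvd int h - int k then \<psi> d h else 0)) \<le> 2 * (37 / 20) ^ (l - d) * A"
      unfolding p_def A_def by (rule coset_pair_sum_le[OF d \<psi>0 \<psi>_per])
    ultimately show ?thesis by (rule order_trans[rotated])
  qed
  have "(\<Sum>n<2 ^ \<nu>. norm (\<Sum>m\<in>{a n..<b n}. tm ((m * (n + r)) mod 2 ^ l) * tm ((m * n) mod 2 ^ l) * ee (of_nat m * \<beta>)))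
     \<le> (\<Sum>n<2 ^ \<nu>. \<Sum>h<2 ^ l. \<Sum>k<2 ^ l. p h * p k * g h k n)"
    unfolding p_def g_def by (intro sum_mono norm_truncated_correlation_le ab)
  also have "\<dots> = (\<Sum>h<2 ^ l. \<Sum>k<2 ^ l. p h * p k * (\<Sum>n<2 ^ \<nu>. g h k n))"
    unfolding sum_distrib_left
    by (rule sum_swap_right)
  also have "\<dots> \<le> (\<Sum>h<2 ^ l. \<Sum>k<2 ^ l. p h * p k * (2 * 2 ^ \<nu> * real l + (\<Sum>d\<le>l. if 2 ^ d dvd int h - int k then 2 * 2 ^ \<nu> * \<psi> d h else 0)))"
    unfolding g_def \<psi>_def using l by (intro sum_mono mult_left_mono gkernel_progression_sum_le mult_nonneg_nonneg p0) auto
  also have "\<dots> = 2 * 2 ^ \<nu> * real l * (\<Sum>h<2 ^ l. p h)\<^sup>2 +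
       2 * 2 ^ \<nu> * (\<Sum>d\<le>l. \<Sum>h<2 ^ l. \<Sum>k<2 ^ l. p h * p k * (if 2 ^ d dvd int h - int k then \<psi> d h else 0))"
  proof -
    have "(\<Sum>h<2 ^ l. \<Sum>k<2 ^ l. p h * p k * (2 * 2 ^ \<nu> * real l + (\<Sum>d\<le>l. if 2 ^ d dvd int h - int k then 2 * 2 ^ \<nu> * \<psi> d h else 0)))
      = (\<Sum>h<2 ^ l. \<Sum>k<2 ^ l. 2 * 2 ^ \<nu> * real l * (p h * p k)) +
        (\<Sum>h<2 ^ l. \<Sum>k<2 ^ l. \<Sum>d\<le>l. 2 * 2 ^ \<nu> * (p h * p k * (if 2 ^ d dvd int h - int k then \<psi> d h else 0)))"
      unfolding sum.distrib[symmetric] distrib_left sum_distrib_left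
      by (intro sum.cong refl arg_cong2[where f = "(+)"]) auto
    also have "(\<Sum>h<2 ^ l. \<Sum>k<2 ^ l. \<Sum>d\<le>l. 2 * 2 ^ \<nu> * (p h * p k * (if 2 ^ d dvd int h - int k then \<psi> d h else 0)))
       = (\<Sum>d\<le>l. \<Sum>h<2 ^ l. \<Sum>k<2 ^ l. 2 * 2 ^ \<nu> * (p h * p k * (if 2 ^ d dvd int h - int k then \<psi> d h else 0)))"
      by (rule sum_swap_right[symmetric])
    also have "(\<Sum>h<2 ^ l. \<Sum>k<2 ^ l. 2 * 2 ^ \<nu> * real l * (p h * p k)) = 2 * 2 ^ \<nu> * real l * (\<Sum>h<2 ^ l. p h)\<^sup>2"
      by (simp only: power2_eq_square sum_product) (simp only: sum_distrib_left)
    finally show ?thesis by (simp only: sum_distrib_left)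
  qed
  also have "\<dots> \<le> 2 * 2 ^ \<nu> * real l * (2 * (2 ^ l * s)) + 2 * 2 ^ \<nu> * (\<Sum>d\<le>l. 10 * 2 ^ l * (real l + 1) * s)"
  proof (intro add_mono mult_left_mono sum_mono S)
    have "(\<Sum>h<2 ^ l. p h)\<^sup>2 \<le> (sqrt (2 * (37 / 20) ^ l))\<^sup>2"
      by (intro power_mono p_sum sum_nonneg p0)
    also have "\<dots> \<le> 2 * (2 ^ l * s)" using s2 by simp
    finally show "(\<Sum>h<2 ^ l. p h)\<^sup>2 \<le> 2 * (2 ^ l * s)" .
  qed auto
  also have "\<dots> = 2 ^ \<nu> * 2 ^ l * s * (4 * real l + 20 * (real l + 1)\<^sup>2)"
    by (simp add: power2_eq_square algebra_simps)
  also have "\<dots> \<le> 2 ^ \<nu> * 2 ^ l * s * (52 * (real l + 1)\<^sup>2)"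
    using s by (intro mult_left_mono) (auto simp: power2_eq_square algebra_simps)
  finally show ?thesis by (simp add: s_def mult_ac)
qed

subsection \<open>Bilinear sums\<close>

text \<open>Without a carry past position \<open>l\<close> both arguments have the same upper
  digits; their common sign occurs twice and cancels.\<close>

lemma thue_morse_mult_truncate:
  assumes "x mod 2 ^ l + y < 2 ^ l"
  shows "thue_morse (x + y) * thue_morse x = thue_morse ((x + y) mod 2 ^ l) * thue_morse (x mod 2 ^ l)"
proof -
  define z u where "z = x div 2 ^ l" and "u = x mod 2 ^ l"
  have x: "x = 2 ^ l * z + u" by (simp add: z_def u_def)
  have u: "u < 2 ^ l" "u + y < 2 ^ l" using assms by (auto simp: u_def)
  have "thue_morse (x + y) = thue_morse z * thue_morse (u + y)"
    using thue_morse_split[OF u(2), of z] by (simp add: x add.assoc)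
  moreover have "thue_morse x = thue_morse z * thue_morse u"
    using thue_morse_split[OF u(1), of z] by (simp add: x)
  moreover have "(x + y) mod 2 ^ l = u + y" using u by (simp add: x add.assoc)
  moreover have "thue_morse z * thue_morse z = 1" by (simp add: thue_morse_def)
  ultimately show ?thesis by (simp add: u_def algebra_simps)
qed

text \<open>
  Adding \<open>m * r\<close> to \<open>m * n\<close> carries into the digits above \<open>Q\<close> only if \<open>m * n\<close> lies within \<open>m * r\<close> below
  a multiple of \<open>Q\<close>, and such a window contains at most \<open>r\<close> multiples of \<open>m\<close>.
\<close>

lemma card_carry_le:
  fixes m r Q N :: nat
  assumes m: "m > 0" and Q: "Q > 0"
  shows "card {n. n < N \<and> Q \<le> m * n mod Q + m * r} \<le> (m * N div Q + 1) * r"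
proof -
  define S where "S z = {n. m * n < (z + 1) * Q \<and> (z + 1) * Q \<le> m * (n + r)}" for z
  have S: "finite (S z)" "card (S z) \<le> r" for z
  proof -
    \<comment> \<open>\<open>T\<close> is the ceiling of \<open>(z + 1) * Q / m\<close>, so the
      window \<open>S z\<close> consists of integers among the \<open>r\<close> just below
      \<open>T\<close>.\<close>
    define T where "T = ((z + 1) * Q + m - 1) div m"
    have *: "T \<le> n \<longleftrightarrow> (z + 1) * Q \<le> m * n" for n
    proof -
      have "T \<le> n \<longleftrightarrow> T < n + 1" by linarith
      also have "\<dots> \<longleftrightarrow> (z + 1) * Q + m - 1 < (n + 1) * m"
        unfolding T_def using m by (rule div_less_iff_less_mult)
      also have "\<dots> \<longleftrightarrow> (z + 1) * Q \<le> m * n" using m by (simp add: algebra_simps) linarith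
      finally show ?thesis .
    qed
    have "S z \<subseteq> {T - r..<T}"
    proof
      fix n assume "n \<in> S z"
      then have "\<not> T \<le> n" "T \<le> n + r" unfolding * by (auto simp: S_def)
      then show "n \<in> {T - r..<T}" by auto
    qed
    then show "finite (S z)" "card (S z) \<le> r"
      using card_mono[of "{T - r..<T}" "S z"] by (auto intro: finite_subset)
  qed
  have "{n. n < N \<and> Q \<le> m * n mod Q + m * r} \<subseteq> (\<Union>z<m * N div Q + 1. S z)"
  proof
    fix n assume n: "n \<in> {n. n < N \<and> Q \<le> m * n mod Q + m * r}"
    define z where "z = m * n div Q"
    have mn: "m * n = z * Q + m * n mod Q" by (simp add: z_def)
    have "m * n mod Q < Q" using Q by simp
    then have "m * n < (z + 1) * Q" using mn by (simp add: algebra_simps)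
    moreover have "(z + 1) * Q \<le> m * (n + r)" using mn n by (simp add: algebra_simps)
    moreover have "z \<le> m * N div Q" unfolding z_def using n by (intro div_le_mono) auto
    ultimately show "n \<in> (\<Union>z<m * N div Q + 1. S z)" by (auto simp: S_def)
  qed
  then have "card {n. n < N \<and> Q \<le> m * n mod Q + m * r} \<le> card (\<Union>z<m * N div Q + 1. S z)"
    using S by (intro card_mono) auto
  also have "\<dots> \<le> (\<Sum>z<m * N div Q + 1. card (S z))" by (rule card_UN_le) simp
  also have "\<dots> \<le> (\<Sum>z<m * N div Q + 1. r)" using S by (intro sum_mono) auto
  finally show ?thesis by simp
qed

section \<open>The van der Corput inequality for a family of sums\<close>

lemma sum_shift_support:
  fixes z :: "nat \<Rightarrow> 'a :: comm_monoid_add"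
  assumes "\<And>n. n < p \<or> N \<le> n \<Longrightarrow> z n = 0"
  shows "(\<Sum>k<N. z (k + p)) = (\<Sum>n<N. z n)"
proof -
  have "(\<Sum>k<N. z (k + p)) = (\<Sum>n\<in>{p..<N + p}. z n)"
    using sum.shift_bounds_nat_ivl[of z 0 p N] by (simp add: lessThan_atLeast0)
  also have "\<dots> = (\<Sum>n<N + p. z n)"
    by (intro sum.mono_neutral_left) (auto intro!: assms)
  also have "\<dots> = (\<Sum>n<N. z n)"
    by (intro sum.mono_neutral_right) (auto intro!: assms)
  finally show ?thesis .
qed

lemma norm_sum_sq_le: "(norm (\<Sum>k\<in>A. f k))\<^sup>2 \<le> card A * (\<Sum>k\<in>A. (norm (f k))\<^sup>2)"
  for f :: "'a \<Rightarrow> complex"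
proof -
  have "(norm (\<Sum>k\<in>A. f k))\<^sup>2 \<le> (\<Sum>k\<in>A. 1 * norm (f k))\<^sup>2"
    by (intro power_mono) (auto intro: norm_sum)
  also have "\<dots> \<le> (\<Sum>k\<in>A. 1\<^sup>2) * (\<Sum>k\<in>A. (norm (f k))\<^sup>2)"
    by (rule Cauchy_Schwarz_ineq_sum)
  finally show ?thesis by simp
qed

text \<open>The inner sum is an average of \<open>R\<close> shifted copies of itself;
  Cauchy--Schwarz over the position \<open>k\<close> and opening the square produce the correlations
  \<open>c p q\<close>, whose diagonal gives the term with \<open>1 / R\<close>. Since
  \<open>z\<close> vanishes below \<open>R\<close>, shifts create no boundary terms. The bound
  \<open>E\<close> is required only after summation over \<open>m\<close>, so cancellation in that
  variable can be used.\<close>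

lemma van_der_corput:
  fixes z :: "'a \<Rightarrow> nat \<Rightarrow> complex" and R N :: nat
  assumes R: "0 < R" and supp: "\<And>m n. n < R \<or> N \<le> n \<Longrightarrow> z m n = 0"
    and z1: "\<And>m n. norm (z m n) \<le> 1" and E0: "0 \<le> E"
    and E: "\<And>r. 0 < r \<Longrightarrow> r < R \<Longrightarrow> norm (\<Sum>m\<in>A. \<Sum>n<N. z m (n + r) * cnj (z m n)) \<le> E"
  shows "(\<Sum>m\<in>A. (norm (\<Sum>n<N. z m n))\<^sup>2) \<le> N * (real (card A) * real N / real R + E)"
proof -
  define c where "c p q = (\<Sum>m\<in>A. \<Sum>k<N. z m (k + p) * cnj (z m (k + q)))" for p q
  have diff: "norm (c p q) \<le> E" if "q < p" "p < R" for p q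
  proof -
    have "c p q = (\<Sum>m\<in>A. \<Sum>n<N. z m (n + (p - q)) * cnj (z m n))"
      unfolding c_def
    proof (rule sum.cong[OF refl])
      fix m
      have "(\<Sum>k<N. z m (k + p) * cnj (z m (k + q))) = (\<Sum>k<N. (\<lambda>n. z m (n + (p - q)) * cnj (z m n)) (k + q))"
        using that by (simp add: add.assoc)
      also have "\<dots> = (\<Sum>n<N. z m (n + (p - q)) * cnj (z m n))"
        using that by (intro sum_shift_support) (auto simp: supp)
      finally show "(\<Sum>k<N. z m (k + p) * cnj (z m (k + q))) = (\<Sum>n<N. z m (n + (p - q)) * cnj (z m n))" .
    qed
    then show ?thesis using E[of "p - q"] that by simp
  qed
  have same: "norm (c p p) \<le> card A * N" for p
  proof -
    have "norm (c p p) \<le> (\<Sum>m\<in>A. \<Sum>k<N. 1)"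
      unfolding c_def
      by (intro order_trans[OF norm_sum] sum_mono) (auto simp: norm_mult intro!: mult_le_one z1)
    then show ?thesis by simp
  qed
  have cnj_c: "c p q = cnj (c q p)" for p q
    by (simp add: c_def mult.commute)
  have c_le: "norm (c p q) \<le> (if p = q then real (card A * N) else 0) + E" if "p < R" "q < R" for p q
  proof -
    consider "p = q" | "q < p" | "p < q" by linarith
    then show ?thesis
    proof cases
      case 3
      have "norm (c p q) = norm (c q p)" by (subst cnj_c) simp
      then show ?thesis using diff[OF 3] that 3 by simp
    qed (use same[of p] diff that E0 in auto)
  qed
  have vdc: "(norm (of_nat R * (\<Sum>n<N. z m n)))\<^sup>2 \<le> N * (\<Sum>k<N. (norm (\<Sum>p<R. z m (k + p)))\<^sup>2)" for m
  proof -
    have "of_nat R * (\<Sum>n<N. z m n) = (\<Sum>p<R. \<Sum>k<N. z m (k + p))"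
      by (subst sum.cong[OF refl sum_shift_support]) (auto simp: supp)
    also have "\<dots> = (\<Sum>k<N. \<Sum>p<R. z m (k + p))" by (rule sum.swap)
    finally show ?thesis using norm_sum_sq_le[of "\<lambda>k. \<Sum>p<R. z m (k + p)" "{..<N}"] by simp
  qed
  have sq: "of_real (\<Sum>m\<in>A. \<Sum>k<N. (norm (\<Sum>p<R. z m (k + p)))\<^sup>2) = (\<Sum>p<R. \<Sum>q<R. c p q)"
  proof -
    have "of_real (\<Sum>m\<in>A. \<Sum>k<N. (norm (\<Sum>p<R. z m (k + p)))\<^sup>2)
       = (\<Sum>m\<in>A. \<Sum>k<N. \<Sum>p<R. \<Sum>q<R. z m (k + p) * cnj (z m (k + q)))"
      by (simp only: of_real_sum complex_norm_square cnj_sum sum_product)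
    also have "\<dots> = (\<Sum>m\<in>A. \<Sum>p<R. \<Sum>q<R. \<Sum>k<N. z m (k + p) * cnj (z m (k + q)))"
      by (rule sum.cong[OF refl]) (rule sum_swap_right)
    also have "\<dots> = (\<Sum>p<R. \<Sum>q<R. c p q)"
      unfolding c_def by (rule sum_swap_right)
    finally show ?thesis .
  qed
  have "(\<Sum>m\<in>A. \<Sum>k<N. (norm (\<Sum>p<R. z m (k + p)))\<^sup>2) \<le> norm (\<Sum>p<R. \<Sum>q<R. c p q)"
    unfolding sq[symmetric] norm_of_real by simp
  also have "\<dots> \<le> (\<Sum>p<R. \<Sum>q<R. (if p = q then real (card A * N) else 0) + E)"
    by (intro order_trans[OF norm_sum] sum_mono c_le) auto
  also have "\<dots> = R * (card A * N) + R * (R * E)"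
    by (simp add: sum.distrib distrib_left)
  finally have main: "(\<Sum>m\<in>A. \<Sum>k<N. (norm (\<Sum>p<R. z m (k + p)))\<^sup>2) \<le> R * (card A * N) + R * (R * E)" .
  have "(real R)\<^sup>2 * (\<Sum>m\<in>A. (norm (\<Sum>n<N. z m n))\<^sup>2) = (\<Sum>m\<in>A. (norm (of_nat R * (\<Sum>n<N. z m n)))\<^sup>2)"
    unfolding norm_mult power_mult_distrib norm_of_nat by (rule sum_distrib_left)
  also have "\<dots> \<le> (\<Sum>m\<in>A. N * (\<Sum>k<N. (norm (\<Sum>p<R. z m (k + p)))\<^sup>2))"
    by (intro sum_mono vdc)
  also have "\<dots> = N * (\<Sum>m\<in>A. \<Sum>k<N. (norm (\<Sum>p<R. z m (k + p)))\<^sup>2)"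
    by (simp only: sum_distrib_left)
  also have "\<dots> \<le> N * (R * (card A * N) + R * (R * E))"
    by (intro mult_left_mono main) simp
  also have "\<dots> = (real R)\<^sup>2 * (N * (real (card A) * real N / real R + E))"
    using R by (simp add: power2_eq_square field_simps)
  finally show ?thesis using R by simp
qed

text \<open>The coefficients \<open>b\<close> depend on \<open>n\<close> alone and leave the sum
  over \<open>m\<close>, in which the twist becomes the linear phase with slope
  \<open>\<alpha> * r\<close>. The first term of the bound comes from the truncated signs, the term
  \<open>10 / 2 ^ t\<close> from carries.\<close>

lemma correlation_le:
  fixes X :: nat and \<alpha> :: real and b :: "nat \<Rightarrow> complex"
  assumes r: "0 < r" "r < 2 ^ t" and ij: "i \<le> j" and t: "2 * t \<le> j"
    and b: "\<And>n. norm (b n) \<le> 1"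
  defines "z \<equiv> \<lambda>m n. if 2 ^ j \<le> n \<and> n < 2 ^ Suc j \<and> m * n \<le> X
     then b n * tm (m * n) * ee (\<alpha> * of_nat (m * n)) else 0"
  shows "norm (\<Sum>m\<in>{2 ^ i..<2 ^ Suc i}. \<Sum>n<2 ^ Suc j. z m (n + r) * cnj (z m n))
     \<le> 2 ^ (i + j) * (104 * 2 ^ (4 * t) * (real (i + 2 * t) + 1)\<^sup>2 * sqrt ((37 / 40) ^ i) + 10 / 2 ^ t)"
proof -
  define A where "A = {2 ^ i..<2 ^ Suc i :: nat}"
  \<comment> \<open>The product \<open>m * r\<close> has about \<open>i + t\<close> binary digits;
    \<open>t\<close> further digits make carries past position \<open>l\<close> occur for a
    proportion of order \<open>1 / 2 ^ t\<close>.\<close>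
  define l where "l = i + 2 * t"
  \<comment> \<open>Averaging over \<open>n\<close> needs \<open>l \<le> \<nu>\<close>. As
    \<open>i \<le> j\<close>, enlarging the range to \<open>2 ^ \<nu>\<close> costs at most the
    factor \<open>2 ^ (2 * t)\<close>.\<close>
  define \<nu> where "\<nu> = max (Suc j) l"
  \<comment> \<open>For fixed \<open>n\<close> the cut-off at \<open>X\<close> leaves an interval of
    \<open>m\<close>, as the geometric sums require; \<open>m * (n + r) \<le> X\<close> already
    implies the condition on \<open>m * n\<close>.\<close>
  define J where "J n = {2 ^ i..<min (2 ^ Suc i) (X div (n + r) + 1)}" for n
  define f g where "f m n = tm (m * (n + r)) * tm (m * n) * ee (of_nat m * (\<alpha> * of_nat r))"
    and "g m n = tm ((m * (n + r)) mod 2 ^ l) * tm ((m * n) mod 2 ^ l) * ee (of_nat m * (\<alpha> * of_nat r))" for m n :: nat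
  define bad where "bad m n \<longleftrightarrow> 2 ^ l \<le> m * n mod 2 ^ l + m * r" for m n
  have J: "J n = {m \<in> A. m * (n + r) \<le> X}" for n
    using r by (auto simp: J_def A_def less_Suc_eq_le less_eq_div_iff_mult_less_eq)
  have fin: "finite A" by (simp add: A_def)
  have inner: "norm (\<Sum>m\<in>A. z m (n + r) * cnj (z m n)) \<le> norm (\<Sum>m\<in>J n. f m n)" for n
  proof (cases "2 ^ j \<le> n \<and> n + r < 2 ^ Suc j")
    case True
    have "z m (n + r) * cnj (z m n) = (if m * (n + r) \<le> X then b (n + r) * cnj (b n) * f m n else 0)" for m
    proof -
      have "\<alpha> * of_nat (m * (n + r)) + - (\<alpha> * of_nat (m * n)) = of_nat m * (\<alpha> * of_nat r)"
        by (simp add: algebra_simps)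
      then have "ee (\<alpha> * of_nat (m * (n + r))) * cnj (ee (\<alpha> * of_nat (m * n))) = ee (of_nat m * (\<alpha> * of_nat r))"
        by (simp only: ee_add[symmetric] ee_minus[symmetric])
      moreover have "m * (n + r) \<le> X \<Longrightarrow> m * n \<le> X" by (simp add: distrib_left)
      ultimately show ?thesis using True by (auto simp: z_def f_def algebra_simps)
    qed
    then have "(\<Sum>m\<in>A. z m (n + r) * cnj (z m n)) = (\<Sum>m\<in>J n. b (n + r) * cnj (b n) * f m n)"
      using fin by (simp add: J sum.inter_filter)
    also have "\<dots> = b (n + r) * cnj (b n) * (\<Sum>m\<in>J n. f m n)" by (simp add: sum_distrib_left)
    also have "norm \<dots> \<le> 1 * norm (\<Sum>m\<in>J n. f m n)"
      unfolding norm_mult by (intro mult_right_mono mult_le_one) (auto simp: b)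
    finally show ?thesis by simp
  qed (auto simp: z_def)
  have fg: "norm (\<Sum>m\<in>J n. f m n) \<le> norm (\<Sum>m\<in>J n. g m n) + (\<Sum>m\<in>A. if bad m n then 2 else 0)" for n
  proof -
    have "norm (f m n - g m n) \<le> (if bad m n then 2 else 0)" for m
    proof (cases "bad m n")
      case True
      have "norm (f m n - g m n) \<le> norm (f m n) + norm (g m n)" by (rule norm_triangle_ineq4)
      then show ?thesis using True by (simp add: f_def g_def norm_mult)
    next
      case False
      then have "thue_morse (m * n + m * r) * thue_morse (m * n) = thue_morse ((m * n + m * r) mod 2 ^ l) * thue_morse ((m * n) mod 2 ^ l)"
        by (intro thue_morse_mult_truncate) (simp add: bad_def)
      then have "tm (m * (n + r)) * tm (m * n) = tm ((m * (n + r)) mod 2 ^ l) * tm ((m * n) mod 2 ^ l)"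
        by (simp only: distrib_left of_int_mult[symmetric])
      then show ?thesis using False by (simp add: f_def g_def)
    qed
    then have "norm (\<Sum>m\<in>J n. f m n - g m n) \<le> (\<Sum>m\<in>J n. if bad m n then 2 else 0)"
      by (intro order_trans[OF norm_sum] sum_mono)
    also have "\<dots> \<le> (\<Sum>m\<in>A. if bad m n then 2 else 0)"
      using fin by (intro sum_mono2) (auto simp: J)
    finally show ?thesis
      using norm_triangle_sub[of "\<Sum>m\<in>J n. f m n" "\<Sum>m\<in>J n. g m n"] by (simp add: sum_subtractf)
  qed
  have bad_le: "(\<Sum>n<2 ^ Suc j. if bad m n then 2 else 0 :: real) \<le> 10 * 2 ^ j / 2 ^ t" if m: "m \<in> A" for m
  proof -
    have "(\<Sum>n<2 ^ Suc j. if bad m n then 2 else 0 :: real) = 2 * real (card {n. n < 2 ^ Suc j \<and> 2 ^ l \<le> m * n mod 2 ^ l + m * r})"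
      by (simp add: bad_def sum.If_cases lessThan_def Int_def)
    also have "\<dots> \<le> 2 * real ((m * 2 ^ Suc j div 2 ^ l + 1) * r)"
      using m by (intro mult_left_mono of_nat_mono card_carry_le) (auto simp: A_def intro: Nat.gr0I)
    also have "\<dots> \<le> 2 * ((4 * 2 ^ j / 2 ^ (2 * t) + 1) * 2 ^ t)"
    proof -
      have "m * 2 ^ Suc j div 2 ^ l \<le> 2 ^ Suc i * 2 ^ Suc j div 2 ^ l"
        using m by (intro div_le_mono mult_right_mono) (auto simp: A_def)
      then have "real (m * 2 ^ Suc j div 2 ^ l) \<le> real (2 ^ Suc i * 2 ^ Suc j div 2 ^ l)" by (rule of_nat_mono)
      also have "\<dots> \<le> real (2 ^ Suc i * 2 ^ Suc j) / real (2 ^ l)" by (rule of_nat_div_le_of_nat)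
      also have "\<dots> = 4 * 2 ^ j / 2 ^ (2 * t)" by (simp add: l_def power_add)
      finally have "real (m * 2 ^ Suc j div 2 ^ l) \<le> 4 * 2 ^ j / 2 ^ (2 * t)" .
      moreover have "real r \<le> 2 ^ t" using r(2) by (metis less_imp_le of_nat_le_iff of_nat_numeral of_nat_power)
      ultimately show ?thesis unfolding of_nat_mult of_nat_add by (intro mult_mono add_mono) auto
    qed
    also have "\<dots> = 8 * 2 ^ j / 2 ^ t + 2 * (2 ^ (2 * t) / 2 ^ t)"
      unfolding mult_2[of t] power_add by (simp add: divide_simps)
    \<comment> \<open>This is the one extra window counted by \<open>+ 1\<close>; the hypothesis
      \<open>2 * t \<le> j\<close> makes it no larger than the main contribution.\<close>
    also have "(2::real) ^ (2 * t) / 2 ^ t \<le> 2 ^ j / 2 ^ t"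
      using t by (intro divide_right_mono power_increasing) auto
    finally show ?thesis by simp
  qed
  have trunc: "(\<Sum>n<2 ^ Suc j. norm (\<Sum>m\<in>J n. g m n)) \<le> 2 ^ (i + j) * (104 * 2 ^ (4 * t) * (real l + 1)\<^sup>2 * sqrt ((37 / 40) ^ i))"
  proof -
    have "(\<Sum>n<2 ^ Suc j. norm (\<Sum>m\<in>J n. g m n)) \<le> (\<Sum>n<2 ^ \<nu>. norm (\<Sum>m\<in>J n. g m n))"
      by (intro sum_mono2 iffD2[OF lessThan_subset_iff] power_increasing) (auto simp: \<nu>_def)
    also have "\<dots> \<le> 52 * 2 ^ \<nu> * 2 ^ l * (real l + 1)\<^sup>2 * sqrt ((37 / 40) ^ l)"
      unfolding J_def g_def
    proof (rule truncated_correlation_sum_le[where M = "2 ^ i"])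
      have "r * 2 ^ i \<le> 2 ^ t * 2 ^ i" using r by (intro mult_right_mono) auto
      also have "\<dots> \<le> 2 ^ l" unfolding l_def power_add[symmetric] by (intro power_increasing) auto
      finally show "r * 2 ^ i \<le> 2 ^ l" .
    qed (use r in \<open>auto simp: \<nu>_def\<close>)
    also have "\<dots> \<le> 52 * 2 ^ (Suc j + 2 * t) * 2 ^ l * (real l + 1)\<^sup>2 * sqrt ((37 / 40) ^ i)"
      using ij by (intro mult_mono power_increasing real_sqrt_le_mono power_decreasing) (auto simp: \<nu>_def l_def)
    also have "\<dots> = 2 ^ (i + j) * (104 * 2 ^ (4 * t) * (real l + 1)\<^sup>2 * sqrt ((37 / 40) ^ i))"
    proof -
      have "Suc j + 2 * t + l = Suc (i + j + 4 * t)" by (simp add: l_def)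
      then have "(2::real) ^ (Suc j + 2 * t) * 2 ^ l = 2 * (2 ^ (i + j) * 2 ^ (4 * t))"
        by (simp only: power_add[symmetric] power_Suc[symmetric])
      then have "52 * (2 ^ (Suc j + 2 * t) * 2 ^ l) * y = 52 * (2 * (2 ^ (i + j) * 2 ^ (4 * t))) * y" for y :: real
        by (simp only:)
      then show ?thesis by (simp only: mult.assoc)
    qed
    finally show ?thesis .
  qed
  have "norm (\<Sum>m\<in>A. \<Sum>n<2 ^ Suc j. z m (n + r) * cnj (z m n)) \<le> (\<Sum>n<2 ^ Suc j. norm (\<Sum>m\<in>A. z m (n + r) * cnj (z m n)))"
    by (subst sum.swap) (rule norm_sum)
  also have "\<dots> \<le> (\<Sum>n<2 ^ Suc j. norm (\<Sum>m\<in>J n. g m n) + (\<Sum>m\<in>A. if bad m n then 2 else 0))"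
    by (intro sum_mono order_trans[OF inner fg])
  also have "\<dots> = (\<Sum>n<2 ^ Suc j. norm (\<Sum>m\<in>J n. g m n)) + (\<Sum>m\<in>A. \<Sum>n<2 ^ Suc j. if bad m n then 2 else 0)"
    unfolding sum.distrib by (subst (2) sum.swap) (rule refl)
  also have "\<dots> \<le> 2 ^ (i + j) * (104 * 2 ^ (4 * t) * (real l + 1)\<^sup>2 * sqrt ((37 / 40) ^ i)) + (\<Sum>m\<in>A. 10 * 2 ^ j / 2 ^ t)"
    by (intro add_mono trunc sum_mono bad_le)
  also have "\<dots> = 2 ^ (i + j) * (104 * 2 ^ (4 * t) * (real l + 1)\<^sup>2 * sqrt ((37 / 40) ^ i) + 10 / 2 ^ t)"
    by (simp add: A_def power_add distrib_left)
  finally show ?thesis by (simp only: A_def l_def)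
qed


text \<open>
  With shifts \<open>r < 2\<^sup>t\<close> for \<open>t = i div 300\<close>, the powers of \<open>2\<^sup>t\<close> lost in \<open>correlation_le\<close> are absorbed
  by its exponential saving.
\<close>

lemma polynomial_geometric_bounded:
  "\<exists>C>0. \<forall>i. (2 * real i + 1)\<^sup>2 * 2 ^ (5 * (i div 300)) * sqrt ((37 / 40) ^ i) \<le> C"
proof -
  have "(\<lambda>i::nat. (2 * real i + 1)\<^sup>2 * (49 / 50) ^ i) \<longlonglongrightarrow> 0" by real_asymp
  then have "Bseq (\<lambda>i::nat. (2 * real i + 1)\<^sup>2 * (49 / 50) ^ i)"
    by (intro convergent_imp_Bseq convergentI)
  then obtain C where C: "C > 0" "\<And>i::nat. norm ((2 * real i + 1)\<^sup>2 * (49 / 50) ^ i) \<le> C"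
    by (elim BseqE) blast
  \<comment> \<open>Four of the five powers of \<open>2 ^ t\<close> undo the loss in
    \<open>correlation_le\<close>; the fifth is the gain that is kept. After squaring,
    \<open>2 ^ (10 * t)\<close> is at most \<open>(103 / 100) ^ i\<close>, and 103/100 * 37/40 is
    below the square of 49/50.\<close>
  have geo: "2 ^ (5 * (i div 300)) * sqrt ((37 / 40) ^ i) \<le> (49 / 50 :: real) ^ i" for i :: nat
  proof (rule power2_le_imp_le)
    have e1: "(2::real) ^ (10 * (i div 300)) \<le> (103 / 100) ^ i"
    proof -
      have "(2::real) \<le> (103 / 100) ^ 30" by (simp add: power_divide)
      then have "(2::real) ^ 10 \<le> ((103 / 100) ^ 30) ^ 10" by (rule power_mono) simp
      then have "(2::real) ^ 10 \<le> (103 / 100) ^ 300" by (simp only: power_mult[symmetric]) simp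
      then have "((2::real) ^ 10) ^ (i div 300) \<le> ((103 / 100) ^ 300) ^ (i div 300)" by (intro power_mono) auto
      also have "\<dots> = (103 / 100 :: real) ^ (300 * (i div 300))" by (simp only: power_mult)
      also have "\<dots> \<le> (103 / 100) ^ i" by (intro power_increasing) auto
      finally show ?thesis by (simp add: power_mult)
    qed
    have "(2 ^ (5 * (i div 300)) * sqrt ((37 / 40) ^ i))\<^sup>2 = 2 ^ (10 * (i div 300)) * (37 / 40 :: real) ^ i"
      by (simp add: power_mult_distrib flip: power_mult)
    also have "\<dots> \<le> (103 / 100) ^ i * (37 / 40) ^ i" by (intro mult_right_mono e1) auto
    also have "\<dots> = (103 / 100 * (37 / 40)) ^ i" by (simp only: power_mult_distrib)
    also have "\<dots> \<le> ((49 / 50)\<^sup>2) ^ i" by (intro power_mono) (auto simp: power2_eq_square)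
    also have "\<dots> = ((49 / 50) ^ i)\<^sup>2" by (simp only: power_mult[symmetric] mult.commute)
    finally show "(2 ^ (5 * (i div 300)) * sqrt ((37 / 40) ^ i))\<^sup>2 \<le> ((49 / 50 :: real) ^ i)\<^sup>2" .
  qed simp
  have "(2 * real i + 1)\<^sup>2 * (2 ^ (5 * (i div 300)) * sqrt ((37 / 40) ^ i)) \<le> C" for i :: nat
  proof -
    have "(2 * real i + 1)\<^sup>2 * (2 ^ (5 * (i div 300)) * sqrt ((37 / 40) ^ i)) \<le> (2 * real i + 1)\<^sup>2 * (49 / 50) ^ i"
      by (intro mult_left_mono geo) simp
    also have "\<dots> \<le> C" by (rule order_trans[OF abs_ge_self C(2)[of i, unfolded real_norm_def]])
    finally show ?thesis .
  qed
  then show ?thesis using C(1) by (auto simp: mult_ac)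
qed

text \<open>Cauchy--Schwarz over \<open>m\<close> removes the coefficients \<open>a\<close>, and van
  der Corput with \<open>R = 2 ^ t\<close> treats the sum over \<open>n\<close>. This bounds a
  square, so only the square root of the gain \<open>2 ^ t\<close> survives.\<close>

lemma bilinear_block_le:
  "\<exists>C>0. \<forall>\<alpha> (X::nat) i j a b. i \<le> j \<and> (\<forall>m. norm (a m) \<le> 1) \<and> (\<forall>n. norm (b n) \<le> 1) \<longrightarrow>
     norm (\<Sum>m\<in>{2 ^ i..<2 ^ Suc i}. \<Sum>n\<in>{2 ^ j..<2 ^ Suc j}.
        if m * n \<le> X then a m * b n * tm (m * n) * ee (\<alpha> * of_nat (m * n)) else 0)
     \<le> C * 2 ^ (i + j) / sqrt (2 ^ (i div 300))"
proof -
  obtain C0 where C0: "C0 > 0" "\<And>i. (2 * real i + 1)\<^sup>2 * 2 ^ (5 * (i div 300)) * sqrt ((37 / 40) ^ i) \<le> C0"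
    using polynomial_geometric_bounded by blast
  \<comment> \<open>This is \<open>2 * (2 + 10 + 104 * C0)\<close>: diagonal, carries and truncated
    correlations, times the 2 in the length \<open>2 ^ Suc j\<close>.\<close>
  define C where "C = 24 + 208 * C0"
  have C: "C > 0" using C0(1) by (simp add: C_def)
  have sq: "(norm (\<Sum>m\<in>{2 ^ i..<2 ^ Suc i}. \<Sum>n\<in>{2 ^ j..<2 ^ Suc j}.
        if m * n \<le> X then a m * b n * tm (m * n) * ee (\<alpha> * of_nat (m * n)) else 0))\<^sup>2 \<le> C * (2 ^ (i + j))\<^sup>2 / 2 ^ (i div 300)"
    if ij: "i \<le> j" and a: "\<And>m. norm (a m) \<le> 1" and b: "\<And>n. norm (b n) \<le> 1"
    for \<alpha> and X i j :: nat and a b :: "nat \<Rightarrow> complex"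
  proof -
    define t where "t = i div 300"
    define A where "A = {2 ^ i..<2 ^ Suc i :: nat}"
    define z where "z m n = (if 2 ^ j \<le> n \<and> n < 2 ^ Suc j \<and> m * n \<le> X
       then b n * tm (m * n) * ee (\<alpha> * of_nat (m * n)) else 0)" for m n
    define E where "E = 2 ^ (i + j) * (104 * 2 ^ (4 * t) * (real (i + 2 * t) + 1)\<^sup>2 * sqrt ((37 / 40) ^ i) + 10 / 2 ^ t)"
    have t: "2 * t \<le> i" by (simp add: t_def)
    have cardA: "card A = 2 ^ i" by (simp add: A_def)
    have E_le: "E \<le> 2 ^ (i + j) * (104 * C0 + 10) / 2 ^ t"
    proof -
      have "2 ^ (4 * t) * (real (i + 2 * t) + 1)\<^sup>2 * sqrt ((37 / 40) ^ i) \<le> 2 ^ (4 * t) * (2 * real i + 1)\<^sup>2 * sqrt ((37 / 40) ^ i)"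
        using t by (intro mult_right_mono mult_left_mono power_mono) auto
      also have "\<dots> = ((2 * real i + 1)\<^sup>2 * 2 ^ (5 * t) * sqrt ((37 / 40) ^ i)) / 2 ^ t"
      proof -
        have "(2::real) ^ (5 * t) = 2 ^ (4 * t) * 2 ^ t" by (simp flip: power_add)
        then show ?thesis by simp
      qed
      also have "\<dots> \<le> C0 / 2 ^ t" unfolding t_def by (intro divide_right_mono C0) auto
      finally have "104 * 2 ^ (4 * t) * (real (i + 2 * t) + 1)\<^sup>2 * sqrt ((37 / 40) ^ i) + 10 / 2 ^ t \<le> (104 * C0 + 10) / 2 ^ t"
        by (simp add: add_divide_distrib)
      then show ?thesis unfolding E_def times_divide_eq_right[symmetric] by (intro mult_left_mono) auto
    qed
    \<comment> \<open>Here \<open>i \<le> j\<close> makes the dyadic block of \<open>n\<close> start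
      at or above \<open>R = 2 ^ t\<close>, as the support condition of
      \<open>van_der_corput\<close> demands.\<close>
    have tj: "(2::nat) ^ t \<le> 2 ^ j" using t ij by (intro power_increasing) auto
    have vdc: "(\<Sum>m\<in>A. (norm (\<Sum>n<2 ^ Suc j. z m n))\<^sup>2) \<le> real (2 ^ Suc j) * (card A * real (2 ^ Suc j) / real (2 ^ t) + E)"
    proof (rule van_der_corput)
      show "norm (\<Sum>m\<in>A. \<Sum>n<2 ^ Suc j. z m (n + r) * cnj (z m n)) \<le> E" if "0 < r" "r < 2 ^ t" for r
        unfolding A_def z_def E_def using that ij t by (intro correlation_le b) auto
    next
      show "z m n = 0" if "n < 2 ^ t \<or> 2 ^ Suc j \<le> n" for m n
      proof -
        have "\<not> (2 ^ j \<le> n \<and> n < 2 ^ Suc j)" using that tj by linarith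
        then show ?thesis by (auto simp: z_def)
      qed
    qed (auto simp: z_def E_def norm_mult b)
    have "(\<Sum>m\<in>A. \<Sum>n\<in>{2 ^ j..<2 ^ Suc j}. if m * n \<le> X then a m * b n * tm (m * n) * ee (\<alpha> * of_nat (m * n)) else 0)
       = (\<Sum>m\<in>A. a m * (\<Sum>n<2 ^ Suc j. z m n))"
    proof (rule sum.cong[OF refl])
      fix m
      have "(\<Sum>n<2 ^ Suc j. z m n) = (\<Sum>n\<in>{2 ^ j..<2 ^ Suc j}. z m n)"
        by (intro sum.mono_neutral_right) (auto simp: z_def)
      then show "(\<Sum>n\<in>{2 ^ j..<2 ^ Suc j}. if m * n \<le> X then a m * b n * tm (m * n) * ee (\<alpha> * of_nat (m * n)) else 0) = a m * (\<Sum>n<2 ^ Suc j. z m n)"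
        by (simp only: sum_distrib_left) (intro sum.cong refl, auto simp: z_def)
    qed
    moreover have "(norm (\<Sum>m\<in>A. a m * (\<Sum>n<2 ^ Suc j. z m n)))\<^sup>2 \<le> card A * (\<Sum>m\<in>A. (norm (a m * (\<Sum>n<2 ^ Suc j. z m n)))\<^sup>2)"
      by (rule norm_sum_sq_le)
    moreover have "(\<Sum>m\<in>A. (norm (a m * (\<Sum>n<2 ^ Suc j. z m n)))\<^sup>2) \<le> (\<Sum>m\<in>A. (norm (\<Sum>n<2 ^ Suc j. z m n))\<^sup>2)"
      unfolding norm_mult using a by (intro sum_mono power_mono mult_left_le_one_le) auto
    ultimately have "(norm (\<Sum>m\<in>A. \<Sum>n\<in>{2 ^ j..<2 ^ Suc j}. if m * n \<le> X then a m * b n * tm (m * n) * ee (\<alpha> * of_nat (m * n)) else 0))\<^sup>2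
       \<le> card A * (\<Sum>m\<in>A. (norm (\<Sum>n<2 ^ Suc j. z m n))\<^sup>2)"
      by (metis (no_types, lifting) mult_left_mono of_nat_0_le_iff order_trans)
    also have "\<dots> \<le> card A * (real (2 ^ Suc j) * (card A * real (2 ^ Suc j) / real (2 ^ t) + E))"
      by (intro mult_left_mono vdc) simp
    also have "\<dots> \<le> card A * (real (2 ^ Suc j) * (card A * real (2 ^ Suc j) / real (2 ^ t) + 2 ^ (i + j) * (104 * C0 + 10) / 2 ^ t))"
      by (intro mult_left_mono add_left_mono E_le) auto
    also have "\<dots> = C * (2 ^ (i + j))\<^sup>2 / 2 ^ t"
      unfolding cardA C_def by (simp add: power_add power2_eq_square field_simps)
    finally show ?thesis by (simp only: A_def t_def)
  qed
  have main: "norm (\<Sum>m\<in>{2 ^ i..<2 ^ Suc i}. \<Sum>n\<in>{2 ^ j..<2 ^ Suc j}.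
        if m * n \<le> X then a m * b n * tm (m * n) * ee (\<alpha> * of_nat (m * n)) else 0) \<le> sqrt C * 2 ^ (i + j) / sqrt (2 ^ (i div 300))"
    if "i \<le> j" "\<And>m. norm (a m) \<le> 1" "\<And>n. norm (b n) \<le> 1"
    for \<alpha> and X i j :: nat and a b :: "nat \<Rightarrow> complex"
  proof -
    have e: "sqrt C * 2 ^ (i + j) / sqrt (2 ^ (i div 300)) = sqrt (C * (2 ^ (i + j))\<^sup>2 / 2 ^ (i div 300))"
      by (simp add: real_sqrt_mult real_sqrt_divide)
    show ?thesis unfolding e by (rule real_le_rsqrt, rule sq) (use that in auto)
  qed
  show ?thesis
    using C main by (intro exI[of _ "sqrt C"]) auto
qed

subsection \<open>Vaughan's identity\<close>

definition moebius_mu :: "nat \<Rightarrow> real" where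
  "moebius_mu n = (if squarefree n then (- 1) ^ card (prime_factors n) else 0)"

lemma abs_moebius_le: "\<bar>moebius_mu n\<bar> \<le> 1"
  by (simp add: moebius_mu_def power_abs)

lemma moebius_prime_mult:
  assumes "prime p" "\<not> p dvd n" "n > 0"
  shows "moebius_mu (p * n) = - moebius_mu n"
proof -
  have co: "coprime p n" using assms by (simp add: prime_imp_coprime)
  have "squarefree (p * n) \<longleftrightarrow> squarefree n"
    using co assms(1) by (metis squarefree_mult_coprime squarefree_multD(2) squarefree_prime)
  moreover have "prime_factors (p * n) = insert p (prime_factors n)"
    using assms by (simp add: prime_factors_product prime_factorization_prime)
  moreover have "p \<notin> prime_factors n" using assms by auto
  ultimately show ?thesis by (simp add: moebius_mu_def)
qed

text \<open>Only squarefree divisors count; for a fixed prime \<open>p\<close> dividing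
  \<open>n\<close> they pair up as \<open>e\<close> and \<open>p * e\<close> with opposite
  signs.\<close>

lemma sum_moebius:
  assumes "n > 0"
  shows "(\<Sum>d | d dvd n. moebius_mu d) = (if n = 1 then 1 else 0)"
proof (cases "n = 1")
  case False
  then obtain p where p: "prime p" "p dvd n" using prime_factor_nat by blast
  have fin: "finite {d. d dvd n}" using assms by simp
  have pos: "d > 0" if "d dvd n" for d using that assms by (auto intro: Nat.gr0I)
  have "(\<Sum>d | d dvd n \<and> p dvd d. moebius_mu d) = (\<Sum>d | d dvd n \<and> p dvd d \<and> squarefree d. moebius_mu d)"
    using fin by (intro sum.mono_neutral_right) (auto simp: moebius_mu_def)
  also have "\<dots> = (\<Sum>d | d dvd n \<and> \<not> p dvd d \<and> squarefree d. - moebius_mu d)"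
  proof (rule sum.reindex_bij_witness[where i = "\<lambda>e. p * e" and j = "\<lambda>d. d div p"])
    fix d assume d: "d \<in> {d. d dvd n \<and> p dvd d \<and> squarefree d}"
    then obtain e where e: "d = p * e" by auto
    have p0: "p > 0" using p by (simp add: prime_gt_0_nat)
    have e0: "e > 0" using d e pos by auto
    have npe: "\<not> p dvd e"
    proof
      assume "p dvd e"
      then have "p\<^sup>2 dvd d" by (simp add: e power2_eq_square)
      then have "is_unit p" using d by (auto simp: squarefree_def)
      then show False using p(1) by auto
    qed
    show "p * (d div p) = d" by (simp add: e)
    have "e dvd n" using d by (auto simp: e dest: dvd_mult_right)
    moreover have "squarefree e" using d squarefree_multD(2)[of p e] by (simp add: e)
    ultimately show "d div p \<in> {d. d dvd n \<and> \<not> p dvd d \<and> squarefree d}" using npe p0 by (simp add: e)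
    show "- moebius_mu (d div p) = moebius_mu d"
      using p0 moebius_prime_mult[OF p(1) npe e0] by (simp add: e)
  next
    fix e assume e: "e \<in> {d. d dvd n \<and> \<not> p dvd d \<and> squarefree d}"
    have p0: "p > 0" using p by (simp add: prime_gt_0_nat)
    show "p * e div p = e" using p0 by simp
    have co: "coprime p e" using p e by (simp add: prime_imp_coprime)
    then have "p * e dvd n" using p e by (simp add: divides_mult)
    moreover have "squarefree (p * e)" using co p e by (simp add: squarefree_mult_coprime squarefree_prime)
    ultimately show "p * e \<in> {d. d dvd n \<and> p dvd d \<and> squarefree d}" by simp
  qed
  also have "\<dots> = (\<Sum>d | d dvd n \<and> \<not> p dvd d. - moebius_mu d)"
    using fin by (intro sum.mono_neutral_left) (auto simp: moebius_mu_def)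
  finally have "(\<Sum>d | d dvd n \<and> p dvd d. moebius_mu d) + (\<Sum>d | d dvd n \<and> \<not> p dvd d. moebius_mu d) = 0"
    by (simp add: sum_negf)
  moreover have "(\<Sum>d | d dvd n. moebius_mu d) = (\<Sum>d | d dvd n \<and> p dvd d. moebius_mu d) + (\<Sum>d | d dvd n \<and> \<not> p dvd d. moebius_mu d)"
    using fin by (subst sum.union_disjoint[symmetric]) (auto intro: sum.cong)
  ultimately show ?thesis using False by simp
qed (simp add: moebius_mu_def)

text \<open>Both sides run over the pairs with \<open>m * d dvd n\<close>, a condition symmetric in
  \<open>m\<close> and \<open>d\<close>.\<close>

lemma sum_dvd_div_swap:
  fixes G :: "nat \<Rightarrow> nat \<Rightarrow> 'a :: comm_monoid_add"
  assumes "n > 0"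
  shows "(\<Sum>m | m dvd n. \<Sum>d | d dvd n div m. G m d) = (\<Sum>d | d dvd n. \<Sum>m | m dvd n div d. G m d)"
proof -
  have *: "{d. d dvd n div m} = {d. d \<in> {d. d dvd n} \<and> m * d dvd n}" if "m dvd n" for m
  proof -
    have "m \<noteq> 0" using assms that by (intro notI) simp
    then have "d dvd n div m \<longleftrightarrow> m * d dvd n" for d
      using that by (simp add: dvd_div_iff_mult mult.commute)
    then show ?thesis using dvd_mult_right by blast
  qed
  have "(\<Sum>m | m dvd n. \<Sum>d | d dvd n div m. G m d) = (\<Sum>m | m dvd n. \<Sum>d\<in>{d. d \<in> {d. d dvd n} \<and> m * d dvd n}. G m d)"
    by (rule sum.cong[OF refl], rule sum.cong) (use * in blast)+
  also have "\<dots> = (\<Sum>d | d dvd n. \<Sum>m\<in>{m. m \<in> {m. m dvd n} \<and> m * d dvd n}. G m d)"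
    using assms by (intro sum.swap_restrict) auto
  also have "\<dots> = (\<Sum>d | d dvd n. \<Sum>m | m dvd n div d. G m d)"
  proof (rule sum.cong[OF refl], rule sum.cong[OF _ refl])
    fix d assume "d \<in> {d. d dvd n}"
    then have "{m. m dvd n div d} = {m. m \<in> {m. m dvd n} \<and> d * m dvd n}" by (intro *) simp
    then show "{m. m \<in> {m. m dvd n} \<and> m * d dvd n} = {m. m dvd n div d}" by (simp only: mult.commute)
  qed
  finally show ?thesis .
qed

lemma moebius_inversion:
  fixes g :: "nat \<Rightarrow> real"
  assumes "n > 0"
  shows "(\<Sum>m | m dvd n. moebius_mu m * (\<Sum>d | d dvd n div m. g d)) = g n"
proof -
  have "(\<Sum>m | m dvd n. moebius_mu m * (\<Sum>d | d dvd n div m. g d)) = (\<Sum>d | d dvd n. \<Sum>m | m dvd n div d. moebius_mu m * g d)"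
    unfolding sum_distrib_left by (rule sum_dvd_div_swap[OF assms])
  also have "\<dots> = (\<Sum>d | d dvd n. if d = n then g n else 0)"
  proof (rule sum.cong[OF refl])
    fix d assume "d \<in> {d. d dvd n}"
    then obtain e where e: "n = d * e" by auto
    then have "n div d = e" "e > 0" "d > 0" using assms by auto
    then show "(\<Sum>m | m dvd n div d. moebius_mu m * g d) = (if d = n then g n else 0)"
      by (auto simp: sum_distrib_right[symmetric] sum_moebius e)
  qed
  also have "\<dots> = g n" using assms by simp
  finally show ?thesis .
qed

lemma sum_divisors_eq:
  fixes G :: "nat \<Rightarrow> nat \<Rightarrow> 'a :: comm_monoid_add"
  shows "(\<Sum>n\<in>{1..N}. \<Sum>m | m dvd n. G m (n div m)) = (\<Sum>m\<in>{1..N}. \<Sum>k\<in>{1..N div m}. G m k)"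
proof -
  have "(\<Sum>n\<in>{1..N}. \<Sum>m | m dvd n. G m (n div m)) = (\<Sum>(n, m)\<in>(SIGMA n:{1..N}. {m. m dvd n}). G m (n div m))"
    by (rule sum.Sigma) auto
  also have "\<dots> = (\<Sum>(m, k)\<in>(SIGMA m:{1..N}. {1..N div m}). G m k)"
  proof (rule sum.reindex_bij_witness[where i = "\<lambda>(m, k). (m * k, m)" and j = "\<lambda>(n, m). (m, n div m)"])
    fix x assume "x \<in> (SIGMA n:{1..N}. {m. m dvd n})"
    then obtain m k where x: "x = (m * k, m)" and mk: "1 \<le> m * k" "m * k \<le> N" by (auto elim!: dvdE)
    have "m > 0" "k > 0" using mk by (auto intro: Nat.gr0I)
    then have "m \<le> m * k" "k \<le> N div m" using mk by (auto simp: less_eq_div_iff_mult_less_eq mult.commute)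
    moreover from this have "m \<le> N" using mk by linarith
    ultimately show "(case x of (n, m) \<Rightarrow> (m, n div m)) \<in> (SIGMA m:{1..N}. {1..N div m})"
      "(case case x of (n, m) \<Rightarrow> (m, n div m) of (m, k) \<Rightarrow> (m * k, m)) = x"
      "(case case x of (n, m) \<Rightarrow> (m, n div m) of (m, k) \<Rightarrow> G m k) = (case x of (n, m) \<Rightarrow> G m (n div m))"
      using mk \<open>m > 0\<close> \<open>k > 0\<close> by (auto simp: x)
  next
    fix x assume "x \<in> (SIGMA m:{1..N}. {1..N div m})"
    then obtain m k where x: "x = (m, k)" and mk: "m > 0" "k > 0" "k \<le> N div m" by auto
    have "m * k \<le> N" using mk by (simp add: less_eq_div_iff_mult_less_eq mult.commute)
    have "m \<le> m * k" using mk by simp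
    then have "m \<le> N" using \<open>m * k \<le> N\<close> by (rule order_trans)
    then show "(case x of (m, k) \<Rightarrow> (m * k, m)) \<in> (SIGMA n:{1..N}. {m. m dvd n})"
      "(case case x of (m, k) \<Rightarrow> (m * k, m) of (n, m) \<Rightarrow> (m, n div m)) = x"
      using mk \<open>m * k \<le> N\<close> by (auto simp: x)
  qed
  also have "\<dots> = (\<Sum>m\<in>{1..N}. \<Sum>k\<in>{1..N div m}. G m k)"
    by (rule sum.Sigma[symmetric]) auto
  finally show ?thesis .
qed

subsection \<open>Sums over multiples\<close>

text \<open>Each of the \<open>q\<close> characters merely shifts the frequency, and dividing by
  \<open>q\<close> averages them. The uniform bound therefore survives without any dependence on the
  modulus.\<close>

lemma norm_tm_multiples_le:
  assumes q: "q > 0" and Y: "q * Y + 1 < 4 ^ K"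
  shows "norm (\<Sum>l\<in>{1..Y}. tm (q * l) * ee (\<alpha> * of_nat (q * l))) \<le> 8 * (7 / 2) ^ K"
proof -
  define f where "f x = tm x * ee (\<alpha> * of_nat x)" for x
  have "of_nat q * (\<Sum>l\<in>{..Y}. f (q * l)) = (\<Sum>x<q * Y + 1. f x * (if int q dvd int x then of_nat q else 0))"
  proof -
    have "(\<Sum>x<q * Y + 1. f x * (if int q dvd int x then of_nat q else 0)) = (\<Sum>x\<in>{x. x < q * Y + 1 \<and> q dvd x}. f x * of_nat q)"
      by (intro sum.mono_neutral_cong_right) auto
    also have "\<dots> = (\<Sum>l\<in>{..Y}. f (q * l) * of_nat q)"
      by (rule sum.reindex_bij_witness[where i = "\<lambda>l. q * l" and j = "\<lambda>x. x div q"])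
         (use q in \<open>auto elim!: dvdE simp: less_Suc_eq_le\<close>)
    finally show ?thesis by (simp add: sum_distrib_left mult.commute)
  qed
  also have "\<dots> = (\<Sum>x<q * Y + 1. f x * (\<Sum>h<q. ee (of_nat h * (of_int (int x) / of_nat q))))"
    by (simp only: sum_ee_fraction[OF q])
  also have "\<dots> = (\<Sum>h<q. \<Sum>x<q * Y + 1. tm x * ee (of_nat x * (\<alpha> + of_nat h / of_nat q)))"
    unfolding sum_distrib_left
  proof (subst sum.swap, rule sum.cong[OF refl], rule sum.cong[OF refl])
    fix h x
    have "of_nat x * (\<alpha> + of_nat h / of_nat q) = \<alpha> * of_nat x + of_nat h * (of_int (int x) / of_nat q)"
      by (simp add: algebra_simps)
    then have "ee (of_nat x * (\<alpha> + of_nat h / of_nat q)) = ee (\<alpha> * of_nat x) * ee (of_nat h * (of_int (int x) / of_nat q))"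
      by (simp only: ee_add)
    then show "f x * ee (of_nat h * (of_int (int x) / of_nat q)) = tm x * ee (of_nat x * (\<alpha> + of_nat h / of_nat q))"
      by (simp only: f_def mult.assoc)
  qed
  finally have "real q * norm (\<Sum>l\<in>{..Y}. f (q * l)) = norm (\<Sum>h<q. \<Sum>x<q * Y + 1. tm x * ee (of_nat x * (\<alpha> + of_nat h / of_nat q)))"
    by (metis norm_mult norm_of_nat)
  also have "\<dots> \<le> (\<Sum>h<q. 8 * (7 / 2) ^ K - 8)"
    by (intro order_trans[OF norm_sum] sum_mono norm_tm_sum_le Y)
  finally have *: "norm (\<Sum>l\<in>{..Y}. f (q * l)) \<le> 8 * (7 / 2) ^ K - 8"
    using q by simp
  \<comment> \<open>Removing the term at 0 costs 1, which the \<open>- 8\<close> in the uniform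
    bound covers.\<close>
  have "(\<Sum>l\<in>{..Y}. f (q * l)) = f 0 + (\<Sum>l\<in>{1..Y}. f (q * l))"
    by (simp add: atMost_atLeast0 sum.atLeast_Suc_atMost)
  then have "(\<Sum>l\<in>{1..Y}. f (q * l)) = (\<Sum>l\<in>{..Y}. f (q * l)) - f 0" by simp
  then have "norm (\<Sum>l\<in>{1..Y}. f (q * l)) \<le> norm (\<Sum>l\<in>{..Y}. f (q * l)) + norm (f 0)"
    by (simp only: norm_triangle_ineq4)
  also have "norm (f 0) = 1" by (simp add: f_def norm_mult)
  finally show ?thesis using * by (simp add: f_def)
qed

text \<open>Partial summation: the increments of the logarithm are nonnegative and add up to
  \<open>ln Y\<close>, and the boundary term costs the same again.\<close>

lemma norm_sum_ln_le:
  fixes g :: "nat \<Rightarrow> complex"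
  assumes "\<And>k. k \<le> Y \<Longrightarrow> norm (\<Sum>l\<in>{1..k}. g l) \<le> B" and "Y > 0"
  shows "norm (\<Sum>l\<in>{1..Y}. of_real (ln (real l)) * g l) \<le> 2 * ln (real Y) * B"
proof -
  define G where "G k = (\<Sum>l\<in>{1..k}. g l)" for k
  have D: "norm ((\<Sum>l\<in>{1..k}. of_real (ln (real l)) * g l) - of_real (ln (real k)) * G k) \<le> ln (real k) * B"
    if "0 < k" "k \<le> Y" for k
    using that
  proof (induction k)
    case (Suc k)
    show ?case
    proof (cases "k = 0")
      case False
      have "(\<Sum>l\<in>{1..Suc k}. of_real (ln (real l)) * g l) - of_real (ln (real (Suc k))) * G (Suc k)
        = ((\<Sum>l\<in>{1..k}. of_real (ln (real l)) * g l) - of_real (ln (real k)) * G k) - of_real (ln (real (Suc k)) - ln (real k)) * G k"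
        by (simp add: G_def algebra_simps)
      also have "norm \<dots> \<le> ln (real k) * B + (ln (real (Suc k)) - ln (real k)) * B"
      proof (rule order_trans[OF norm_triangle_ineq4 add_mono])
        show "norm ((\<Sum>l\<in>{1..k}. of_real (ln (real l)) * g l) - of_real (ln (real k)) * G k) \<le> ln (real k) * B"
          using Suc False by simp
        have "0 \<le> ln (real (Suc k)) - ln (real k)" using False by simp
        moreover have "norm (G k) \<le> B" unfolding G_def using Suc.prems by (intro assms) simp
        ultimately show "norm (of_real (ln (real (Suc k)) - ln (real k)) * G k) \<le> (ln (real (Suc k)) - ln (real k)) * B"
          unfolding norm_mult norm_of_real by (intro mult_mono) auto
      qed
      finally show ?thesis by (simp add: algebra_simps)
    qed (simp add: G_def)
  qed simp
  have "norm (of_real (ln (real Y)) * G Y) \<le> ln (real Y) * B"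
    unfolding norm_mult norm_of_real G_def using assms by (intro mult_mono) auto
  then show ?thesis
    using D[of Y] norm_triangle_sub[of "\<Sum>l\<in>{1..Y}. of_real (ln (real l)) * g l" "of_real (ln (real Y)) * G Y"] assms(2)
    by simp
qed

section \<open>Splitting the von Mangoldt function at a cut-off\<close>

definition big_mangoldt :: "nat \<Rightarrow> nat \<Rightarrow> real" where
  "big_mangoldt P d = (if d < P then 0 else mangoldt d)"

definition small_mangoldt :: "nat \<Rightarrow> nat \<Rightarrow> real" where
  "small_mangoldt P d = (if d < P then mangoldt d else 0)"

lemma small_mangoldt_nonneg [simp]: "0 \<le> small_mangoldt P d"
  by (simp add: small_mangoldt_def mangoldt_nonneg)

lemma big_mangoldt_nonneg [simp]: "0 \<le> big_mangoldt P d"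
  by (simp add: big_mangoldt_def mangoldt_nonneg)

lemma sum_small_mangoldt_le:
  assumes "Y \<le> N"
  shows "(\<Sum>d\<in>{1..Y}. small_mangoldt P d) \<le> P * ln (real N)"
proof (cases "N = 0")
  case False
  have "(\<Sum>d\<in>{1..Y}. small_mangoldt P d) = (\<Sum>d\<in>{1..Y} \<inter> {..<P}. mangoldt d)"
    by (intro sum.mono_neutral_cong_right) (auto simp: small_mangoldt_def)
  also have "\<dots> \<le> (\<Sum>d\<in>{1..Y} \<inter> {..<P}. ln (real N))"
  proof (rule sum_mono)
    fix d assume d: "d \<in> {1..Y} \<inter> {..<P}"
    then have "mangoldt d \<le> ln (real d)" by (intro mangoldt_le) auto
    also have "\<dots> \<le> ln (real N)" using d assms by simp
    finally show "mangoldt d \<le> ln (real N)" .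
  qed
  also have "\<dots> = card ({1..Y} \<inter> {..<P}) * ln (real N)" by simp
  also have "\<dots> \<le> P * ln (real N)"
  proof (intro mult_right_mono)
    show "real (card ({1..Y} \<inter> {..<P})) \<le> real P"
      using card_mono[of "{..<P}" "{1..Y} \<inter> {..<P}"] by simp
  qed (use False in simp)
  finally show ?thesis .
qed (use assms in simp)

text \<open>This serves twice: it bounds the coefficient by the logarithm, and it trades the large
  divisors for a smooth weight and divisors below \<open>P\<close>, which suits the linear
  sums.\<close>

lemma big_mangoldt_divisor_sum:
  assumes "k > 0"
  shows "(\<Sum>d | d dvd k. big_mangoldt P d) = ln (real k) - (\<Sum>d | d dvd k. small_mangoldt P d)"
proof -
  have "(\<Sum>d | d dvd k. big_mangoldt P d) + (\<Sum>d | d dvd k. small_mangoldt P d) = (\<Sum>d | d dvd k. mangoldt d)"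
    unfolding sum.distrib[symmetric] by (intro sum.cong refl) (auto simp: big_mangoldt_def small_mangoldt_def)
  also have "\<dots> = ln (real k)" using mangoldt_sum[of k, where ?'a = real] assms by simp
  finally show ?thesis by simp
qed

text \<open>The upper part of the von Mangoldt function is recovered by Moebius inversion from its
  divisor sums \<open>b\<close>. These vanish for \<open>0 < k < P\<close>, so restricting to
  \<open>m \<ge> P\<close> later leaves both variables at least \<open>P\<close>.\<close>

lemma vaughan:
  fixes f :: "nat \<Rightarrow> complex" and N P :: nat
  defines "b \<equiv> \<lambda>k. \<Sum>d | d dvd k. big_mangoldt P d"
  shows "(\<Sum>n\<in>{1..N}. of_real (mangoldt n) * f n) =
    (\<Sum>n\<in>{1..N}. of_real (small_mangoldt P n) * f n) +
    (\<Sum>m\<in>{1..N}. \<Sum>k\<in>{1..N div m}. of_real (moebius_mu m * b k) * f (m * k))"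
proof -
  have "(\<Sum>n\<in>{1..N}. of_real (big_mangoldt P n) * f n) = (\<Sum>n\<in>{1..N}. \<Sum>m | m dvd n. of_real (moebius_mu m * b (n div m)) * f (m * (n div m)))"
  proof (rule sum.cong[OF refl])
    fix n assume n: "n \<in> {1..N}"
    have "big_mangoldt P n = (\<Sum>m | m dvd n. moebius_mu m * b (n div m))"
      unfolding b_def using n by (intro moebius_inversion[symmetric]) auto
    then have "of_real (big_mangoldt P n) * f n = (\<Sum>m | m dvd n. of_real (moebius_mu m * b (n div m)) * f n)"
      by (simp add: sum_distrib_right)
    also have "\<dots> = (\<Sum>m | m dvd n. of_real (moebius_mu m * b (n div m)) * f (m * (n div m)))"
      by (rule sum.cong[OF refl]) auto
    finally show "of_real (big_mangoldt P n) * f n = (\<Sum>m | m dvd n. of_real (moebius_mu m * b (n div m)) * f (m * (n div m)))" .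
  qed
  also have "\<dots> = (\<Sum>m\<in>{1..N}. \<Sum>k\<in>{1..N div m}. of_real (moebius_mu m * b k) * f (m * k))"
    by (rule sum_divisors_eq)
  finally have big: "(\<Sum>n\<in>{1..N}. of_real (big_mangoldt P n) * f n) =
    (\<Sum>m\<in>{1..N}. \<Sum>k\<in>{1..N div m}. of_real (moebius_mu m * b k) * f (m * k))" .
  have "(\<Sum>n\<in>{1..N}. of_real (mangoldt n) * f n) =
    (\<Sum>n\<in>{1..N}. of_real (small_mangoldt P n) * f n) + (\<Sum>n\<in>{1..N}. of_real (big_mangoldt P n) * f n)"
    unfolding sum.distrib[symmetric] by (intro sum.cong refl) (auto simp: big_mangoldt_def small_mangoldt_def)
  then show ?thesis by (simp only: big)
qed

text \<open>The logarithm is removed by partial summation, giving the 2. The divisors below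
  \<open>P\<close> are pulled out, leaving sums over multiples of \<open>m * d\<close>; their
  weights add up to at most \<open>P * ln N\<close>.\<close>

lemma type_one_le:
  fixes \<alpha> :: real
  defines "f \<equiv> \<lambda>n. tm n * ee (\<alpha> * of_nat n)"
  assumes m: "m > 0" "m \<le> N" and N: "N + 1 < 4 ^ K"
  shows "norm (\<Sum>k\<in>{1..N div m}. of_real (\<Sum>d | d dvd k. big_mangoldt P d) * f (m * k))
     \<le> (2 + real P) * ln (real N) * (8 * (7 / 2) ^ K)"
proof -
  define Y where "Y = N div m"
  define B :: real where "B = 8 * (7 / 2) ^ K"
  have Y: "Y > 0" "Y \<le> N" "m * Y \<le> N" using m by (auto simp: Y_def div_greater_zero_iff)
  have lnN: "0 \<le> ln (real N)" "ln (real Y) \<le> ln (real N)" using Y by auto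
  have mult: "norm (\<Sum>l\<in>{1..k}. f (m * (d * l))) \<le> B" if "d > 0" "d * k \<le> Y" for d k
  proof -
    have "m * (d * k) \<le> m * Y" using that by (intro mult_left_mono) auto
    then have "m * (d * k) + 1 < 4 ^ K" using Y(3) N by linarith
    then have "(m * d) * k + 1 < 4 ^ K" by (simp only: mult.assoc)
    then show ?thesis
      using norm_tm_multiples_le[of "m * d" k K \<alpha>] m that by (simp add: f_def B_def mult.assoc)
  qed
  have "(\<Sum>k\<in>{1..Y}. of_real (\<Sum>d | d dvd k. big_mangoldt P d) * f (m * k))
     = (\<Sum>k\<in>{1..Y}. of_real (ln (real k)) * f (m * k)) - (\<Sum>k\<in>{1..Y}. \<Sum>d | d dvd k. of_real (small_mangoldt P d) * f (m * (d * (k div d))))"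
    unfolding sum_subtractf[symmetric]
  proof (rule sum.cong[OF refl])
    fix k assume "k \<in> {1..Y}"
    then have "of_real (\<Sum>d | d dvd k. big_mangoldt P d) * f (m * k) = of_real (ln (real k)) * f (m * k) - (\<Sum>d | d dvd k. of_real (small_mangoldt P d) * f (m * k))"
      by (simp add: big_mangoldt_divisor_sum sum_distrib_right left_diff_distrib)
    also have "(\<Sum>d | d dvd k. of_real (small_mangoldt P d) * f (m * k)) = (\<Sum>d | d dvd k. of_real (small_mangoldt P d) * f (m * (d * (k div d))))"
      by (rule sum.cong[OF refl]) auto
    finally show "of_real (\<Sum>d | d dvd k. big_mangoldt P d) * f (m * k) = of_real (ln (real k)) * f (m * k) - (\<Sum>d | d dvd k. of_real (small_mangoldt P d) * f (m * (d * (k div d))))" .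
  qed
  also have "(\<Sum>k\<in>{1..Y}. \<Sum>d | d dvd k. of_real (small_mangoldt P d) * f (m * (d * (k div d))))
     = (\<Sum>d\<in>{1..Y}. of_real (small_mangoldt P d) * (\<Sum>l\<in>{1..Y div d}. f (m * (d * l))))"
    unfolding sum_distrib_left by (rule sum_divisors_eq)
  finally have eq: "(\<Sum>k\<in>{1..Y}. of_real (\<Sum>d | d dvd k. big_mangoldt P d) * f (m * k))
     = (\<Sum>k\<in>{1..Y}. of_real (ln (real k)) * f (m * k)) - (\<Sum>d\<in>{1..Y}. of_real (small_mangoldt P d) * (\<Sum>l\<in>{1..Y div d}. f (m * (d * l))))" .
  have "norm (\<Sum>k\<in>{1..Y}. of_real (ln (real k)) * f (m * k)) \<le> 2 * ln (real Y) * B"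
    using mult[of 1] Y by (intro norm_sum_ln_le) auto
  also have "\<dots> \<le> 2 * ln (real N) * B"
    using lnN by (intro mult_right_mono mult_left_mono) (auto simp: B_def)
  finally have 1: "norm (\<Sum>k\<in>{1..Y}. of_real (ln (real k)) * f (m * k)) \<le> 2 * ln (real N) * B" .
  have "norm (\<Sum>d\<in>{1..Y}. of_real (small_mangoldt P d) * (\<Sum>l\<in>{1..Y div d}. f (m * (d * l)))) \<le> (\<Sum>d\<in>{1..Y}. small_mangoldt P d * B)"
  proof (intro order_trans[OF norm_sum] sum_mono)
    fix d assume d: "d \<in> {1..Y}"
    have "norm (\<Sum>l\<in>{1..Y div d}. f (m * (d * l))) \<le> B" using d by (intro mult) auto
    then show "norm (of_real (small_mangoldt P d) * (\<Sum>l\<in>{1..Y div d}. f (m * (d * l)))) \<le> small_mangoldt P d * B"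
      unfolding norm_mult norm_of_real by (intro mult_mono) auto
  qed
  also have "\<dots> = (\<Sum>d\<in>{1..Y}. small_mangoldt P d) * B" by (simp only: sum_distrib_right)
  also have "\<dots> \<le> (P * ln (real N)) * B"
    using Y by (intro mult_right_mono sum_small_mangoldt_le) (auto simp: B_def)
  finally have 2: "norm (\<Sum>d\<in>{1..Y}. of_real (small_mangoldt P d) * (\<Sum>l\<in>{1..Y div d}. f (m * (d * l)))) \<le> (P * ln (real N)) * B" .
  have "norm (\<Sum>k\<in>{1..Y}. of_real (\<Sum>d | d dvd k. big_mangoldt P d) * f (m * k)) \<le> 2 * ln (real N) * B + P * ln (real N) * B"
    unfolding eq by (rule order_trans[OF norm_triangle_ineq4 add_mono[OF 1 2]])
  then show ?thesis by (simp add: Y_def B_def algebra_simps)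
qed

section \<open>Assembling dyadic blocks and the linear and bilinear ranges\<close>

lemma sum_dyadic:
  fixes g :: "nat \<Rightarrow> 'a :: comm_monoid_add"
  assumes "u \<le> L"
  shows "(\<Sum>m\<in>{2 ^ u..<2 ^ L}. g m) = (\<Sum>i\<in>{u..<L}. \<Sum>m\<in>{2 ^ i..<2 ^ Suc i}. g m)"
  using assms
proof (induction rule: dec_induct)
  case (step L)
  have "(\<Sum>m\<in>{2 ^ u..<2 ^ L}. g m) + (\<Sum>m\<in>{2 ^ L..<2 ^ Suc L}. g m) = (\<Sum>m\<in>{2 ^ u..<2 ^ Suc L}. g m)"
    using step.hyps by (intro sum.atLeastLessThan_concat power_increasing) auto
  then show ?case using step by (simp add: sum.atLeastLessThan_Suc)
qed simp

text \<open>There are at most \<open>L * L\<close> blocks. Those with \<open>2 ^ (i + j) > N\<close>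
  are empty, and in all others the shorter side is at least \<open>2 ^ u\<close>, so each gains what
  that length allows.\<close>

lemma type_two_le:
  "\<exists>C>0. \<forall>\<alpha> (N::nat) u L (a::nat \<Rightarrow> complex) b. (\<forall>m. norm (a m) \<le> 1) \<and> (\<forall>n. norm (b n) \<le> 1) \<and> u \<le> L \<longrightarrow>
     norm (\<Sum>m\<in>{2 ^ u..<2 ^ L}. \<Sum>n\<in>{2 ^ u..<2 ^ L}.
        if m * n \<le> N then a m * b n * tm (m * n) * ee (\<alpha> * of_nat (m * n)) else 0)
     \<le> C * (real L)\<^sup>2 * N / sqrt (2 ^ (u div 300))"
proof -
  obtain C where C: "C > 0" and block: "\<And>\<alpha> (X::nat) i j (a::nat \<Rightarrow> complex) b. i \<le> j \<Longrightarrow> (\<And>m. norm (a m) \<le> 1) \<Longrightarrow> (\<And>n. norm (b n) \<le> 1) \<Longrightarrow>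
     norm (\<Sum>m\<in>{2 ^ i..<2 ^ Suc i}. \<Sum>n\<in>{2 ^ j..<2 ^ Suc j}.
        if m * n \<le> X then a m * b n * tm (m * n) * ee (\<alpha> * of_nat (m * n)) else 0)
     \<le> C * 2 ^ (i + j) / sqrt (2 ^ (i div 300))"
    using bilinear_block_le by blast
  have "norm (\<Sum>m\<in>{2 ^ u..<2 ^ L}. \<Sum>n\<in>{2 ^ u..<2 ^ L}.
        if m * n \<le> N then a m * b n * tm (m * n) * ee (\<alpha> * of_nat (m * n)) else 0)
     \<le> C * (real L)\<^sup>2 * N / sqrt (2 ^ (u div 300))"
    if a: "\<And>m. norm (a m) \<le> 1" and b: "\<And>n. norm (b n) \<le> 1" and uL: "u \<le> L"
    for \<alpha> and N u L :: nat and a b :: "nat \<Rightarrow> complex"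
  proof -
    define g where "g a b m n = (if m * n \<le> N then a m * b n * tm (m * n) * ee (\<alpha> * of_nat (m * n)) else 0)"
      for a b :: "nat \<Rightarrow> complex" and m n
    define D where "D = C * N / sqrt (2 ^ (u div 300))"
    have D: "0 \<le> D" using C by (simp add: D_def)
    have le: "norm (\<Sum>m\<in>{2 ^ i..<2 ^ Suc i}. \<Sum>n\<in>{2 ^ j..<2 ^ Suc j}. g a b m n) \<le> D"
      if ij: "u \<le> i" "i \<le> j" and a: "\<And>m. norm (a m) \<le> 1" and b: "\<And>n. norm (b n) \<le> 1" for i j a b
    proof (cases "2 ^ (i + j) \<le> N")
      case True
      have "norm (\<Sum>m\<in>{2 ^ i..<2 ^ Suc i}. \<Sum>n\<in>{2 ^ j..<2 ^ Suc j}. g a b m n) \<le> C * 2 ^ (i + j) / sqrt (2 ^ (i div 300))"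
        unfolding g_def by (intro block ij a b)
      also have "\<dots> \<le> C * N / sqrt (2 ^ (u div 300))"
      proof (intro frac_le mult_left_mono)
        show "2 ^ (i + j) \<le> real N" using True by (metis of_nat_le_iff of_nat_numeral of_nat_power)
        show "sqrt (2 ^ (u div 300)) \<le> sqrt (2 ^ (i div 300))"
          using ij by (intro real_sqrt_le_mono power_increasing div_le_mono) auto
      qed (use C in auto)
      finally show ?thesis by (simp add: D_def)
    next
      case False
      have "g a b m n = 0" if "m \<in> {2 ^ i..<2 ^ Suc i}" "n \<in> {2 ^ j..<2 ^ Suc j}" for m n
      proof -
        have "2 ^ i * 2 ^ j \<le> m * n" using that by (intro mult_mono) auto
        then show ?thesis using False by (simp add: g_def power_add)
      qed
      then have "(\<Sum>m\<in>{2 ^ i..<2 ^ Suc i}. \<Sum>n\<in>{2 ^ j..<2 ^ Suc j}. g a b m n) = 0"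
        by (intro sum.neutral ballI) auto
      then show ?thesis using D by simp
    qed
    \<comment> \<open>The block estimate wants the smaller variable first; exchanging the roles of
      \<open>a\<close> and \<open>b\<close> reduces to that case.\<close>
    have all: "norm (\<Sum>m\<in>{2 ^ i..<2 ^ Suc i}. \<Sum>n\<in>{2 ^ j..<2 ^ Suc j}. g a b m n) \<le> D"
      if ij: "u \<le> i" "u \<le> j" for i j
    proof (cases "i \<le> j")
      case False
      have "g a b m n = g b a n m" for m n by (simp add: g_def mult.commute)
      then have "(\<Sum>m\<in>{2 ^ i..<2 ^ Suc i}. \<Sum>n\<in>{2 ^ j..<2 ^ Suc j}. g a b m n) = (\<Sum>n\<in>{2 ^ j..<2 ^ Suc j}. \<Sum>m\<in>{2 ^ i..<2 ^ Suc i}. g b a n m)"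
        by (subst sum.swap) simp
      then show ?thesis using le[of j i b a] False ij a b by simp
    qed (use le ij a b in auto)
    have "(\<Sum>m\<in>{2 ^ u..<2 ^ L}. \<Sum>n\<in>{2 ^ u..<2 ^ L}. g a b m n)
       = (\<Sum>i\<in>{u..<L}. \<Sum>m\<in>{2 ^ i..<2 ^ Suc i}. \<Sum>j\<in>{u..<L}. \<Sum>n\<in>{2 ^ j..<2 ^ Suc j}. g a b m n)"
      by (simp only: sum_dyadic[OF uL])
    also have "\<dots> = (\<Sum>i\<in>{u..<L}. \<Sum>j\<in>{u..<L}. \<Sum>m\<in>{2 ^ i..<2 ^ Suc i}. \<Sum>n\<in>{2 ^ j..<2 ^ Suc j}. g a b m n)"
      by (rule sum.cong[OF refl]) (rule sum.swap)
    finally have eq: "(\<Sum>m\<in>{2 ^ u..<2 ^ L}. \<Sum>n\<in>{2 ^ u..<2 ^ L}. g a b m n)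
       = (\<Sum>i\<in>{u..<L}. \<Sum>j\<in>{u..<L}. \<Sum>m\<in>{2 ^ i..<2 ^ Suc i}. \<Sum>n\<in>{2 ^ j..<2 ^ Suc j}. g a b m n)" .
    have "norm (\<Sum>m\<in>{2 ^ u..<2 ^ L}. \<Sum>n\<in>{2 ^ u..<2 ^ L}. g a b m n) \<le> (\<Sum>i\<in>{u..<L}. \<Sum>j\<in>{u..<L}. D)"
      unfolding eq by (intro order_trans[OF norm_sum] sum_mono all) auto
    also have "\<dots> = real (L - u) * real (L - u) * D"
      by (simp only: sum_constant card_atLeastLessThan mult.assoc)
    also have "\<dots> \<le> real L * real L * D" using D by (intro mult_right_mono mult_mono) auto
    finally show ?thesis by (simp add: g_def D_def power2_eq_square mult_ac)
  qed
  then show ?thesis using C by blast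
qed


text \<open>With \<open>P = 2 ^ u\<close>, fewer than \<open>P\<close> linear sums each lose a
  factor of order \<open>P\<close>, which explains \<open>4 ^ u\<close>. All other \<open>m\<close>
  enter the bilinear sum.\<close>

lemma prime_sum_le:
  "\<exists>C>0. \<forall>\<alpha> N u K. N \<ge> 2 \<and> N + 1 < 4 ^ K \<and> u \<le> K \<longrightarrow>
     norm (\<Sum>n\<in>{1..N}. of_real (mangoldt n) * (tm n * ee (\<alpha> * of_nat n)))
     \<le> ln (real N) * (25 * 4 ^ u * (7 / 2) ^ K + C * (real K)\<^sup>2 * 4 ^ K / sqrt (2 ^ (u div 300)))"
proof -
  obtain C where C: "C > 0" and two: "\<And>\<alpha> (N::nat) u L (a::nat \<Rightarrow> complex) b. (\<And>m. norm (a m) \<le> 1) \<Longrightarrow> (\<And>n. norm (b n) \<le> 1) \<Longrightarrow> u \<le> L \<Longrightarrow>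
     norm (\<Sum>m\<in>{2 ^ u..<2 ^ L}. \<Sum>n\<in>{2 ^ u..<2 ^ L}.
        if m * n \<le> N then a m * b n * tm (m * n) * ee (\<alpha> * of_nat (m * n)) else 0)
     \<le> C * (real L)\<^sup>2 * N / sqrt (2 ^ (u div 300))"
    using type_two_le by blast
  have "norm (\<Sum>n\<in>{1..N}. of_real (mangoldt n) * (tm n * ee (\<alpha> * of_nat n)))
     \<le> ln (real N) * (25 * 4 ^ u * (7 / 2) ^ K + 4 * C * (real K)\<^sup>2 * 4 ^ K / sqrt (2 ^ (u div 300)))"
    if N: "N \<ge> 2" "N + 1 < 4 ^ K" and u: "u \<le> K" for \<alpha> N u K
  proof -
    define f where "f n = tm n * ee (\<alpha> * of_nat n)" for n
    define P :: nat where "P = 2 ^ u"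
    define L where "L = 2 * K"
    define b where "b k = (\<Sum>d | d dvd k. big_mangoldt P d)" for k
    define l where "l = ln (real N)"
    have l: "l > 0" using N by (simp add: l_def)
    have NL: "N < 2 ^ L" using N by (simp add: L_def power_mult)
    have P: "P \<ge> 1" by (simp add: P_def)
    have norm_f: "norm (f n) = 1" for n by (simp add: f_def norm_mult)
    have b_nonneg: "0 \<le> b k" for k by (simp add: b_def sum_nonneg)
    have b_le: "b k \<le> l" if "0 < k" "k \<le> N" for k
    proof -
      have "b k \<le> ln (real k)" unfolding b_def using that
        by (simp add: big_mangoldt_divisor_sum sum_nonneg)
      also have "\<dots> \<le> l" using that by (simp add: l_def)
      finally show ?thesis .
    qed
    have b_zero: "b k = 0" if "0 < k" "k < P" for k
      unfolding b_def using that by (intro sum.neutral) (auto simp: big_mangoldt_def dest: dvd_imp_le)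
    define T where "T m = (\<Sum>k\<in>{1..N div m}. of_real (moebius_mu m * b k) * f (m * k))" for m
    have S0: "norm (\<Sum>n\<in>{1..N}. of_real (small_mangoldt P n) * f n) \<le> P * l"
    proof -
      have "norm (\<Sum>n\<in>{1..N}. of_real (small_mangoldt P n) * f n) \<le> (\<Sum>n\<in>{1..N}. small_mangoldt P n)"
        by (intro order_trans[OF norm_sum] sum_mono) (simp add: norm_mult norm_f)
      then show ?thesis using sum_small_mangoldt_le[of N N P] by (simp add: l_def)
    qed
    have T1: "norm (\<Sum>m\<in>{1..N} \<inter> {..<P}. T m) \<le> P * ((2 + real P) * l * (8 * (7 / 2) ^ K))"
    proof -
      have "norm (T m) \<le> (2 + real P) * l * (8 * (7 / 2) ^ K)" if m: "m \<in> {1..N} \<inter> {..<P}" for m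
      proof -
        have "T m = of_real (moebius_mu m) * (\<Sum>k\<in>{1..N div m}. of_real (b k) * f (m * k))"
          by (simp add: T_def sum_distrib_left mult.assoc)
        also have "norm \<dots> \<le> 1 * norm (\<Sum>k\<in>{1..N div m}. of_real (b k) * f (m * k))"
          unfolding norm_mult norm_of_real by (intro mult_right_mono abs_moebius_le) auto
        also have "norm (\<Sum>k\<in>{1..N div m}. of_real (b k) * f (m * k)) \<le> (2 + real P) * l * (8 * (7 / 2) ^ K)"
          unfolding b_def f_def l_def using m N by (intro type_one_le) auto
        finally show ?thesis by simp
      qed
      then have "norm (\<Sum>m\<in>{1..N} \<inter> {..<P}. T m) \<le> (\<Sum>m\<in>{1..N} \<inter> {..<P}. (2 + real P) * l * (8 * (7 / 2) ^ K))"
        by (intro order_trans[OF norm_sum] sum_mono)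
      also have "\<dots> = card ({1..N} \<inter> {..<P}) * ((2 + real P) * l * (8 * (7 / 2) ^ K))" by simp
      also have "\<dots> \<le> P * ((2 + real P) * l * (8 * (7 / 2) ^ K))"
        using l card_mono[of "{..<P}" "{1..N} \<inter> {..<P}"] by (intro mult_right_mono) auto
      finally show ?thesis .
    qed
    have T2: "norm (\<Sum>m\<in>{1..N} - {..<P}. T m) \<le> l * (4 * C * (real K)\<^sup>2 * 4 ^ K / sqrt (2 ^ (u div 300)))"
    proof -
      define a' where "a' m = complex_of_real (moebius_mu m)" for m
      \<comment> \<open>Division by the logarithm makes the coefficients bounded by 1, and the
        restriction to \<open>0 < k \<le> N\<close> confines them to where \<open>b_le\<close>
        applies.\<close>
      define b' where "b' k = complex_of_real (if 0 < k \<and> k \<le> N then b k / l else 0)" for k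
      define g where "g m k = (if m * k \<le> N then a' m * b' k * tm (m * k) * ee (\<alpha> * of_nat (m * k)) else 0)" for m k
      have a': "norm (a' m) \<le> 1" for m by (simp add: a'_def abs_moebius_le)
      have b': "norm (b' k) \<le> 1" for k using l b_le[of k] b_nonneg[of k] by (simp add: b'_def)
      have T_eq: "T m = of_real l * (\<Sum>k\<in>{P..<2 ^ L}. g m k)" if m: "m \<in> {1..N} - {..<P}" for m
        unfolding T_def sum_distrib_left
      proof (rule sum.mono_neutral_cong)
        fix k assume k: "k \<in> {P..<2 ^ L} - {1..N div m}"
        then have "\<not> m * k \<le> N" using m P by (auto simp: less_eq_div_iff_mult_less_eq mult.commute)
        then show "of_real l * g m k = 0" by (simp add: g_def)
      next
        fix k assume k: "k \<in> {1..N div m} - {P..<2 ^ L}"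
        then have "k \<le> N div m" by simp
        then have "k \<le> N" by (rule order_trans[OF _ div_le_dividend])
        then have "0 < k" "k < P" using k NL by auto
        then show "of_real (moebius_mu m * b k) * f (m * k) = 0" by (simp add: b_zero)
      next
        fix k assume k: "k \<in> {1..N div m} \<inter> {P..<2 ^ L}"
        then have "m * k \<le> N" using m by (auto simp: less_eq_div_iff_mult_less_eq mult.commute)
        moreover have "k \<le> N" using k by (intro order_trans[OF _ div_le_dividend[of N m]]) simp
        moreover have "0 < k" using k by auto
        ultimately show "of_real (moebius_mu m * b k) * f (m * k) = of_real l * g m k"
          using l by (simp add: g_def a'_def b'_def f_def)
      qed auto
      have "(\<Sum>m\<in>{1..N} - {..<P}. T m) = (\<Sum>m\<in>{P..<2 ^ L}. of_real l * (\<Sum>k\<in>{P..<2 ^ L}. g m k))"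
      proof (rule sum.mono_neutral_cong_left)
        show "\<forall>m\<in>{P..<2 ^ L} - ({1..N} - {..<P}). of_real l * (\<Sum>k\<in>{P..<2 ^ L}. g m k) = 0"
        proof
          fix m assume m: "m \<in> {P..<2 ^ L} - ({1..N} - {..<P})"
          then have "N < m" using P by auto
          have "g m k = 0" if k: "k \<in> {P..<2 ^ L}" for k
          proof -
            have "m * 1 \<le> m * k" using k P by (intro mult_left_mono) auto
            then have "\<not> m * k \<le> N" using \<open>N < m\<close> by linarith
            then show ?thesis by (simp add: g_def)
          qed
          then show "of_real l * (\<Sum>k\<in>{P..<2 ^ L}. g m k) = 0" by simp
        qed
      qed (use NL T_eq in auto)
      also have "\<dots> = of_real l * (\<Sum>m\<in>{P..<2 ^ L}. \<Sum>k\<in>{P..<2 ^ L}. g m k)"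
        by (simp only: sum_distrib_left)
      finally have "norm (\<Sum>m\<in>{1..N} - {..<P}. T m) = l * norm (\<Sum>m\<in>{P..<2 ^ L}. \<Sum>k\<in>{P..<2 ^ L}. g m k)"
        using l by (simp add: norm_mult)
      also have "\<dots> \<le> l * (C * (real L)\<^sup>2 * N / sqrt (2 ^ (u div 300)))"
        unfolding g_def P_def using l u by (intro mult_left_mono two a' b') (auto simp: L_def)
      also have "\<dots> \<le> l * (C * (real L)\<^sup>2 * 4 ^ K / sqrt (2 ^ (u div 300)))"
      proof -
        have "real N \<le> real (4 ^ K)" using N by (intro of_nat_mono) simp
        then show ?thesis using l C by (intro mult_left_mono divide_right_mono) auto
      qed
      also have "C * (real L)\<^sup>2 * 4 ^ K = 4 * C * (real K)\<^sup>2 * 4 ^ K"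
        by (simp add: L_def power2_eq_square)
      finally show ?thesis .
    qed
    have "(\<Sum>n\<in>{1..N}. of_real (mangoldt n) * f n) = (\<Sum>n\<in>{1..N}. of_real (small_mangoldt P n) * f n) + (\<Sum>m\<in>{1..N}. T m)"
      unfolding T_def b_def by (rule vaughan)
    also have "(\<Sum>m\<in>{1..N}. T m) = (\<Sum>m\<in>{1..N} \<inter> {..<P}. T m) + (\<Sum>m\<in>{1..N} - {..<P}. T m)"
      by (rule sum.Int_Diff) simp
    finally have "norm (\<Sum>n\<in>{1..N}. of_real (mangoldt n) * f n) \<le>
        P * l + (P * ((2 + real P) * l * (8 * (7 / 2) ^ K)) + l * (4 * C * (real K)\<^sup>2 * 4 ^ K / sqrt (2 ^ (u div 300))))"
      using norm_triangle_le[OF add_mono[OF S0 norm_triangle_le[OF add_mono[OF T1 T2]]]] by simp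
    also have "\<dots> = l * (P + 8 * P * (2 + real P) * (7 / 2) ^ K + 4 * C * (real K)\<^sup>2 * 4 ^ K / sqrt (2 ^ (u div 300)))"
      by (simp add: algebra_simps)
    \<comment> \<open>Since \<open>P * P = 4 ^ u\<close> and \<open>P \<le> 4 ^ u\<close>, the lone
      \<open>P\<close> contributes 1 and \<open>8 * P * (2 + P)\<close> contributes 24.\<close>
    also have "\<dots> \<le> l * (25 * 4 ^ u * (7 / 2) ^ K + 4 * C * (real K)\<^sup>2 * 4 ^ K / sqrt (2 ^ (u div 300)))"
    proof (intro mult_left_mono add_right_mono)
      have P2: "real P * real P = 4 ^ u" by (simp add: P_def flip: power_mult_distrib)
      have P1: "1 \<le> real P" using P by simp
      have "real P * 1 \<le> real P * real P" using P1 by (intro mult_left_mono) auto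
      then have PP: "real P \<le> 4 ^ u" by (simp add: P2)
      have A: "1 \<le> (7 / 2 :: real) ^ K" by simp
      have "real P * 1 \<le> 4 ^ u * (7 / 2) ^ K" using PP A by (intro mult_mono) auto
      moreover have "8 * real P * (2 + real P) * (7 / 2) ^ K \<le> 24 * 4 ^ u * (7 / 2) ^ K"
      proof (rule mult_right_mono)
        have "8 * real P * (2 + real P) = 16 * real P + 8 * (real P * real P)" by (simp add: algebra_simps)
        then show "8 * real P * (2 + real P) \<le> 24 * 4 ^ u" using PP unfolding P2 by linarith
      qed simp
      ultimately show "P + 8 * P * (2 + real P) * (7 / 2) ^ K \<le> 25 * 4 ^ u * (7 / 2) ^ K" by linarith
    qed (use l in simp)
    finally show ?thesis by (simp add: f_def l_def)
  qed
  then show ?thesis using C by (intro exI[of _ "4 * C"]) auto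
qed

section \<open>Choice of parameters and exponents\<close>

lemma cubic_geometric_bounded:
  "\<exists>C>0. \<forall>K::nat. (real K + 1) ^ 3 * (2 powr (- 1 / 36000)) ^ K \<le> C"
proof -
  have "(\<lambda>K::nat. (real K + 1) ^ 3 * 2 powr (- real K / 36000)) \<longlonglongrightarrow> 0" by real_asymp
  then have "Bseq (\<lambda>K::nat. (real K + 1) ^ 3 * 2 powr (- real K / 36000))"
    by (intro convergent_imp_Bseq convergentI)
  then obtain C where C: "C > 0" "\<And>K::nat. norm ((real K + 1) ^ 3 * 2 powr (- real K / 36000)) \<le> C"
    by (elim BseqE) blast
  have "(2 powr (- 1 / 36000)) ^ K = 2 powr (- real K / 36000)" for K
    by (simp add: powr_power mult.commute)
  then have "(real K + 1) ^ 3 * (2 powr (- 1 / 36000)) ^ K \<le> C" for K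
    using abs_le_D1[OF C(2)[of K, unfolded real_norm_def]] by (simp only:)
  then show ?thesis using C(1) by blast
qed

text \<open>The choice of \<open>u\<close> gives \<open>4 ^ u \<le> (21 / 20) ^ K\<close>, and 21/20
  * 7/2 = 4 * 147/160 still saves a power. On the bilinear side
  \<open>u div 300 = K div 9000\<close>, so the square root saves about
  \<open>2 powr (- K / 18000)\<close>; \<open>v\<close> is chosen to make this
  \<open>v ^ (2 * K)\<close>.\<close>

lemma power_tradeoff:
  fixes K :: nat
  defines "v \<equiv> 2 powr (- 1 / 36000) :: real" and "u \<equiv> K div 30"
  shows "4 ^ u * (7 / 2) ^ K \<le> 4 ^ K * v ^ (2 * K)" "1 / sqrt (2 ^ (u div 300)) \<le> 2 * v ^ (2 * K)"
proof -
  have v: "0 < v" "v \<le> 1" using powr_mono[of "- 1 / 36000" 0 2] by (auto simp: v_def)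
  have v_pow: "v ^ 36000 = 1 / 2"
  proof -
    have "v ^ 36000 = v powr (real 36000)" by (rule powr_realpow[symmetric, OF v(1)])
    also have "\<dots> = 2 powr (- 1)" by (simp only: v_def powr_powr) simp
    finally show ?thesis by (simp add: powr_minus_divide)
  qed
  show "4 ^ u * (7 / 2) ^ K \<le> 4 ^ K * v ^ (2 * K)"
  proof -
    have "(4::real) \<le> (21 / 20) ^ 30" by (simp add: power_divide)
    then have "(4::real) ^ u \<le> ((21 / 20) ^ 30) ^ u" by (intro power_mono) auto
    also have "\<dots> = (21 / 20) ^ (30 * u)" by (simp only: power_mult)
    also have "\<dots> \<le> (21 / 20) ^ K" by (intro power_increasing) (auto simp: u_def)
    finally have "4 ^ u * (7 / 2) ^ K \<le> (21 / 20) ^ K * (7 / 2 :: real) ^ K" by (intro mult_right_mono) auto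
    also have "\<dots> = 4 ^ K * (147 / 160) ^ K" by (simp flip: power_mult_distrib)
    also have "\<dots> \<le> 4 ^ K * (v ^ 2) ^ K"
    proof (intro mult_left_mono power_mono)
      show "147 / 160 \<le> v\<^sup>2"
      \<comment> \<open>Tenth powers decide: \<open>(147 / 160) ^ 10 < 1 / 2\<close>, whereas
        \<open>v ^ 20\<close> is at least \<open>v ^ 36000 = 1 / 2\<close>.\<close>
      proof (rule ccontr)
        assume "\<not> 147 / 160 \<le> v\<^sup>2"
        then have "(v\<^sup>2) ^ 10 \<le> (147 / 160) ^ 10" by (intro power_mono) auto
        also have "\<dots> < (1 / 2 :: real)" by (simp add: power_divide)
        finally have "v ^ 20 < 1 / 2" by (simp flip: power_mult)
        moreover have "v ^ 36000 \<le> v ^ 20" using v by (intro power_decreasing) auto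
        ultimately show False using v_pow by simp
      qed
    qed auto
    finally show ?thesis by (simp add: power_mult)
  qed
  show "1 / sqrt (2 ^ (u div 300)) \<le> 2 * v ^ (2 * K)"
  proof (rule power2_le_imp_le)
    define q where "q = K div 9000"
    have q: "u div 300 = q" by (simp add: u_def q_def div_mult2_eq[symmetric])
    have "K \<le> 9000 * Suc q"
      using div_mult_mod_eq[of K 9000] mod_less_divisor[of 9000 K] by (simp add: q_def)
    then have "4 * K \<le> 36000 * Suc q" by simp
    then have "v ^ (36000 * Suc q) \<le> v ^ (4 * K)" using v by (intro power_decreasing) auto
    then have "(1 / 2) ^ Suc q \<le> v ^ (4 * K)" by (simp only: power_mult v_pow)
    then have "1 / 2 * (1 / 2) ^ q \<le> v ^ (4 * K)" by (simp only: power_Suc)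
    moreover have "0 \<le> v ^ (4 * K)" using v by simp
    \<comment> \<open>Rounding in \<open>K div 9000\<close> costs one factor 2; it is enlarged to 4
      so that the right-hand side is a square.\<close>
    ultimately have "(1 / 2) ^ q \<le> 4 * v ^ (4 * K)" by linarith
    then have "1 / 2 ^ q \<le> 4 * v ^ (4 * K)" by (simp only: power_one_over)
    moreover have "(v ^ (2 * K))\<^sup>2 = v ^ (4 * K)" by (simp flip: power_mult)
    ultimately show "(1 / sqrt (2 ^ (u div 300)))\<^sup>2 \<le> (2 * v ^ (2 * K))\<^sup>2"
      by (simp add: q power_divide power_mult_distrib)
  qed (use v in simp)
qed

theorem theorem1:
  "\<exists>\<kappa>::real. \<kappa> > 0 \<and> (\<exists>C::real. \<forall>(\<alpha>::real) (X::real). X \<ge> 2 \<longrightarrow>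
     norm (\<Sum>n | 1 \<le> n \<and> real n \<le> X.
        of_int (thue_morse n) * mangoldt n * exp (2 * of_real pi * \<i> * of_real \<alpha> * of_nat n) :: complex)
       \<le> C * X powr (1 - \<kappa>))"
proof -
  obtain C1 where C1: "C1 > 0" and main: "\<And>\<alpha> N u K. N \<ge> 2 \<Longrightarrow> N + 1 < 4 ^ K \<Longrightarrow> u \<le> K \<Longrightarrow>
     norm (\<Sum>n\<in>{1..N}. of_real (mangoldt n) * (tm n * ee (\<alpha> * of_nat n)))
     \<le> ln (real N) * (25 * 4 ^ u * (7 / 2) ^ K + C1 * (real K)\<^sup>2 * 4 ^ K / sqrt (2 ^ (u div 300)))"
    using prime_sum_le by blast
  obtain C2 where C2: "C2 > 0" "\<And>K::nat. (real K + 1) ^ 3 * (2 powr (- 1 / 36000)) ^ K \<le> C2"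
    using cubic_geometric_bounded by blast
  \<comment> \<open>The saving \<open>v ^ (2 * K)\<close> is the power \<open>- 1 / 36000\<close> of
    \<open>4 ^ K\<close>. One factor \<open>v ^ K\<close> absorbs the cubic
    \<open>(K + 1) ^ 3\<close>, made of \<open>ln N\<close> and the count of dyadic blocks; the
    other is the power \<open>- \<kappa>\<close>.\<close>
  define \<kappa> :: real where "\<kappa> = 1 / 72000"
  define v :: real where "v = 2 powr (- 1 / 36000)"
  \<comment> \<open>The 3 comes from \<open>ln N \<le> 3 * K\<close>, the 8 from
    \<open>4 ^ K \<le> 8 * X\<close>.\<close>
  define C where "C = 3 * (25 + 2 * C1) * C2 * 8"
  have v: "0 < v" by (simp add: v_def)
  have "norm (\<Sum>n | 1 \<le> n \<and> real n \<le> X.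
        of_int (thue_morse n) * mangoldt n * exp (2 * of_real pi * \<i> * of_real \<alpha> * of_nat n) :: complex)
       \<le> C * X powr (1 - \<kappa>)" if X: "X \<ge> 2" for \<alpha> X
  proof -
    define N where "N = nat \<lfloor>X\<rfloor>"
    have N: "N \<ge> 2" "real N \<le> X" using X by (auto simp: N_def le_nat_floor)
    have set_eq: "{n. 1 \<le> n \<and> real n \<le> X} = {1..N}"
      using X by (auto simp: N_def le_nat_floor le_nat_iff le_floor_iff)
    \<comment> \<open>Minimality gives \<open>4 ^ K \<le> 4 * (N + 1)\<close>, so passing from
      \<open>X\<close> to \<open>4 ^ K\<close> costs only a constant factor.\<close>
    define K where "K = (LEAST K. N + 1 < 4 ^ K)"
    have ex: "N + 1 < 4 ^ (N + 1)" using power_gt_expt[of 4 "N + 1"] by simp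
    have K: "N + 1 < 4 ^ K" unfolding K_def by (rule LeastI[of "\<lambda>K. N + 1 < 4 ^ K", OF ex])
    have "K > 0" using K by (intro Nat.gr0I) auto
    then have "\<not> N + 1 < 4 ^ (K - 1)" using not_less_Least[of "K - 1" "\<lambda>K. N + 1 < 4 ^ K"] by (simp add: K_def)
    then have "4 * 4 ^ (K - 1) \<le> 4 * (N + 1)" by simp
    then have "4 ^ K \<le> 4 * (N + 1)" using \<open>K > 0\<close> by (simp flip: power_Suc)
    then have "real (4 ^ K) \<le> real (4 * (N + 1))" by (rule of_nat_mono)
    then have K2: "4 ^ K \<le> 8 * X" using N X by simp
    define u where "u = K div 30"
    have lnN: "0 \<le> ln (real N)" "ln (real N) \<le> 3 * real K"
    proof -
      have "real N \<le> real (4 ^ K)" using K by (intro of_nat_mono) simp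
      then have "ln (real N) \<le> ln (4 ^ K)" using N by simp
      also have "\<dots> = real K * ln 4" by (simp add: ln_realpow)
      also have "\<dots> \<le> real K * 3" using ln_le_minus_one[of 4] by (intro mult_left_mono) auto
      finally show "ln (real N) \<le> 3 * real K" by simp
    qed (use N in simp)
    have "exp (2 * of_real pi * \<i> * of_real \<alpha> * of_nat n) = ee (\<alpha> * of_nat n)" for n
      by (simp add: ee_def cis_conv_exp mult_ac)
    then have "norm (\<Sum>n | 1 \<le> n \<and> real n \<le> X.
        of_int (thue_morse n) * mangoldt n * exp (2 * of_real pi * \<i> * of_real \<alpha> * of_nat n) :: complex)
      = norm (\<Sum>n\<in>{1..N}. of_real (mangoldt n) * (tm n * ee (\<alpha> * of_nat n)))"
      unfolding set_eq by (simp add: mult_ac)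
    also have "\<dots> \<le> ln (real N) * (25 * 4 ^ u * (7 / 2) ^ K + C1 * (real K)\<^sup>2 * 4 ^ K / sqrt (2 ^ (u div 300)))"
      by (intro main N K) (simp add: u_def)
    also have "\<dots> \<le> (3 * (real K + 1)) * ((25 + 2 * C1) * (real K + 1)\<^sup>2 * (4 ^ K * v ^ (2 * K)))"
    proof (rule mult_mono)
      have one: "1 \<le> (real K + 1)\<^sup>2" using one_le_power[of "real K + 1" 2] by simp
      have "25 * (4 ^ u * (7 / 2) ^ K) \<le> 25 * ((real K + 1)\<^sup>2 * (4 ^ K * v ^ (2 * K)))"
        using power_tradeoff(1)[of K] one v
        by (intro mult_left_mono order_trans[OF _ mult_right_mono[OF one]]) (auto simp: u_def v_def)
      moreover have "C1 * (real K)\<^sup>2 * 4 ^ K * (1 / sqrt (2 ^ (u div 300))) \<le> C1 * (real K + 1)\<^sup>2 * 4 ^ K * (2 * v ^ (2 * K))"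
        using power_tradeoff(2)[of K] C1 v
        by (intro mult_mono mult_left_mono power_mono) (auto simp: u_def v_def)
      ultimately show "25 * 4 ^ u * (7 / 2) ^ K + C1 * (real K)\<^sup>2 * 4 ^ K / sqrt (2 ^ (u div 300)) \<le> (25 + 2 * C1) * (real K + 1)\<^sup>2 * (4 ^ K * v ^ (2 * K))"
        by (simp add: algebra_simps)
    qed (use lnN C1 in auto)
    also have "\<dots> = 3 * (25 + 2 * C1) * ((real K + 1) ^ 3 * v ^ K) * (4 ^ K * v ^ K)"
    proof -
      have v2: "v ^ (2 * K) = v ^ K * v ^ K" by (simp add: mult_2 power_add)
      show ?thesis unfolding v2 by (simp only: power2_eq_square power3_eq_cube mult_ac)
    qed
    also have "\<dots> \<le> 3 * (25 + 2 * C1) * C2 * (4 ^ K * v ^ K)"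
      using C1 C2(2)[of K] v by (intro mult_right_mono mult_left_mono) (auto simp: v_def)
    also have "4 ^ K * v ^ K = (4 ^ K) powr (1 - \<kappa>)"
    proof -
      have "4 * v = 4 powr (1 - \<kappa>)"
      proof -
        have "(4::real) powr (1 - \<kappa>) = 4 * 4 powr (- \<kappa>)" by (simp add: powr_diff powr_minus divide_inverse)
        also have "(4::real) powr (- \<kappa>) = (2 powr 2) powr (- \<kappa>)" by simp
        also have "\<dots> = v" by (simp only: powr_powr) (simp add: v_def \<kappa>_def)
        finally show ?thesis by simp
      qed
      then have "4 ^ K * v ^ K = (4 powr (1 - \<kappa>)) ^ K" by (simp flip: power_mult_distrib)
      also have "\<dots> = (4 ^ K) powr (1 - \<kappa>)"
        by (simp add: powr_power powr_realpow[symmetric] powr_powr mult.commute)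
      finally show ?thesis .
    qed
    also have "3 * (25 + 2 * C1) * C2 * (4 ^ K) powr (1 - \<kappa>) \<le> 3 * (25 + 2 * C1) * C2 * (8 * X powr (1 - \<kappa>))"
    proof (rule mult_left_mono)
      have "(4 ^ K) powr (1 - \<kappa>) \<le> (8 * X) powr (1 - \<kappa>)"
        using K2 by (intro powr_mono2) (auto simp: \<kappa>_def)
      also have "\<dots> = 8 powr (1 - \<kappa>) * X powr (1 - \<kappa>)" using X by (simp add: powr_mult)
      also have "\<dots> \<le> 8 powr 1 * X powr (1 - \<kappa>)"
        by (intro mult_right_mono powr_mono) (auto simp: \<kappa>_def)
      finally show "(4 ^ K) powr (1 - \<kappa>) \<le> 8 * X powr (1 - \<kappa>)" by simp
    qed (use C1 C2 in simp)
    finally show ?thesis by (simp add: C_def mult.assoc)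
  qed
  moreover have "\<kappa> > 0" by (simp add: \<kappa>_def)
  ultimately show ?thesis by blast
qed

end
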